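(* Let $n\ge1$ be an integer and let $b\in\mathbb{C}$ with $(n+1)b\in\mathbb{N}_0$. Then the $\mathfrak{sl}_{n+1}(\mathbb{C})$-module $M_b^{\{1,\ldots,n\}}$ has a unique nonzero proper submodule $W$; this $W$ is simple and belongs to $\mathfrak{M}$ but not to $\mathcal{M}$. The corresponding quotient $M_b^{\{1,\ldots,n\}}/W$ is simple, has dimension $\binom{(n+1)b+n}{n}$, and has lowest weight $\lambda$, where $\lambda(h_i)=b-\delta_{i,1}(n+1)b$ for $1\le i\le n$.
   Context: $\mathbb{N}_0$ is the set of nonnegative integers. Let $e_{i,j}$ be the matrix units, $\mathfrak{h}$ the diagonal Cartan subalgebra of $\mathfrak{sl}_{n+1}$, $h_k:=e_{k,k}-\frac1{n+1}\sum_{m=1}^{n+1}e_{m,m}$ for $1\le k\le n$, so $\mathcal{U}(\mathfrak{h})=\mathcal{P}:=\mathbb{C}[h_1,\ldots,h_n]$, and $\overline{h}:=\sum_{i=1}^n h_i$. For $1\le i\le n$, $\sigma_i$ is the algebra automorphism of $\mathcal{P}$ with $\sigma_i(h_k)=h_k-\delta_{i,k}$. $M_b^{\{1,\ldots,n\}}$ is the vector space $\mathcal{P}$ with the $\mathfrak{sl}_{n+1}$-action, for $i,j,k\in\{1,\ldots,n\}$ (with $i\ne j$ in the last formula): $h_k\cdot f=h_kf$; $e_{i,n+1}\cdot f=(\overline h+b)\sigma_if$; $e_{n+1,j}\cdot f=-(h_j-b)\sigma_j^{-1}f$; $e_{i,j}\cdot f=(h_j-b)\sigma_i\sigma_j^{-1}f$.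 $\mathfrak{M}$ is the full subcategory of $\mathfrak{sl}_{n+1}$-modules whose restriction to $\mathcal{U}(\mathfrak{h})$ is finitely generated, and $\mathcal{M}$ the full subcategory of those whose restriction to $\mathcal{U}(\mathfrak{h})$ is free of rank $1$. The lowest weight of a simple module is the weight $\lambda\in\mathfrak{h}^*$ of a nonzero weight vector killed by all strictly lower triangular matrices.
   Formalization: The claim that W does not belong to 𝓜 is stated only for n ≥ 2; for n = 1 it is false, since W is a nonzero ideal of the principal ideal domain ℂ[h_1], hence free of rank 1 (e.g. b = 0, W = h_1ℂ[h_1]). *)

theory Defs
  imports "Jordan_Normal_Form.VS_Connect" "HOL-Library.Poly_Mapping" "HOL-Algebra.QuotRing"
    "HOL.Complex"
begin

text \<open>Rows and columns of matrices are numbered from 0 in the library. Here matrix units, the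
  elements \<open>h\<^sub>k\<close> and the polynomial variables keep their customary indices starting with 1.\<close>

definition sl_mat :: "nat \<Rightarrow> complex mat set" where
  "sl_mat n = {A \<in> carrier_mat (Suc n) (Suc n). (\<Sum>r<Suc n. A $$ (r, r)) = 0}"

definition lie_bracket :: "complex mat \<Rightarrow> complex mat \<Rightarrow> complex mat" where
  "lie_bracket A B = A * B - B * A"

definition e_mat :: "nat \<Rightarrow> nat \<Rightarrow> nat \<Rightarrow> complex mat" where
  "e_mat n i j = mat (Suc n) (Suc n) (\<lambda>(r, c). if Suc r = i \<and> Suc c = j then 1 else 0)"

definition h_mat :: "nat \<Rightarrow> nat \<Rightarrow> complex mat" where
  "h_mat n k = e_mat n k k - (1 / of_nat (Suc n)) \<cdot>\<^sub>m 1\<^sub>m (Suc n)"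

definition cartan :: "nat \<Rightarrow> complex mat set" where
  "cartan n = {H \<in> sl_mat n. \<forall>r<Suc n. \<forall>c<Suc n. r \<noteq> c \<longrightarrow> H $$ (r, c) = 0}"

definition cartan_dual :: "nat \<Rightarrow> (complex mat \<Rightarrow> complex) set" where
  "cartan_dual n = {wt. (\<forall>H\<in>cartan n. \<forall>K\<in>cartan n. wt (H + K) = wt H + wt K) \<and>
                       (\<forall>c. \<forall>H\<in>cartan n. wt (c \<cdot>\<^sub>m H) = c * wt H)}"

definition strictly_lower :: "nat \<Rightarrow> complex mat set" where
  "strictly_lower n =
     {A \<in> carrier_mat (Suc n) (Suc n). \<forall>r<Suc n. \<forall>c<Suc n. r \<le> c \<longrightarrow> A $$ (r, c) = 0}"

record 'v lie_rep = "(complex, 'v) module" +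
  act :: "complex mat \<Rightarrow> 'v \<Rightarrow> 'v"

locale sl_module = vectorspace "class_ring :: complex ring" V
  for n :: nat and V :: "'v lie_rep" (structure) +
  assumes act_closed: "\<lbrakk>A \<in> sl_mat n; v \<in> carrier V\<rbrakk> \<Longrightarrow> act V A v \<in> carrier V"
    and act_add_right: "\<lbrakk>A \<in> sl_mat n; v \<in> carrier V; w \<in> carrier V\<rbrakk> \<Longrightarrow>
          act V A (v \<oplus> w) = act V A v \<oplus> act V A w"
    and act_smult_right: "\<lbrakk>A \<in> sl_mat n; v \<in> carrier V\<rbrakk> \<Longrightarrow>
          act V A (c \<odot> v) = c \<odot> act V A v"
    and act_add_left: "\<lbrakk>A \<in> sl_mat n; B \<in> sl_mat n; v \<in> carrier V\<rbrakk> \<Longrightarrow>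
          act V (A + B) v = act V A v \<oplus> act V B v"
    and act_smult_left: "\<lbrakk>A \<in> sl_mat n; v \<in> carrier V\<rbrakk> \<Longrightarrow>
          act V (c \<cdot>\<^sub>m A) v = c \<odot> act V A v"
    and act_bracket: "\<lbrakk>A \<in> sl_mat n; B \<in> sl_mat n; v \<in> carrier V\<rbrakk> \<Longrightarrow>
          act V (lie_bracket A B) v = act V A (act V B v) \<ominus> act V B (act V A v)"

definition sl_submodule :: "nat \<Rightarrow> 'v lie_rep \<Rightarrow> 'v set \<Rightarrow> bool" where
  "sl_submodule n V W \<longleftrightarrow> VectorSpace.subspace (class_ring :: complex ring) W V \<and>
     (\<forall>A\<in>sl_mat n. \<forall>w\<in>W. act V A w \<in> W)"

definition nonzero_proper_submodule :: "nat \<Rightarrow> 'v lie_rep \<Rightarrow> 'v set \<Rightarrow> bool" where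
  "nonzero_proper_submodule n V W \<longleftrightarrow> sl_submodule n V W \<and> W \<noteq> {\<zero>\<^bsub>V\<^esub>} \<and> W \<noteq> carrier V"

definition sub_rep :: "'v lie_rep \<Rightarrow> 'v set \<Rightarrow> 'v lie_rep" where
  "sub_rep V W = V\<lparr>carrier := W\<rparr>"

text \<open>The operations on cosets are written as unions, as in \<^const>\<open>rcoset_mult\<close>, so that no
  representatives have to be chosen; the ring multiplication and unit inherited from the
  record \<open>module\<close> play no role.\<close>

definition quot_rep :: "'v lie_rep \<Rightarrow> 'v set \<Rightarrow> 'v set lie_rep" where
  "quot_rep V W =
     \<lparr>carrier = a_rcosets\<^bsub>V\<^esub> W, mult = undefined, one = undefined, zero = W, add = set_add V,
      smult = (\<lambda>c X. \<Union>x\<in>X. W +>\<^bsub>V\<^esub> (c \<odot>\<^bsub>V\<^esub> x)),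
      act = (\<lambda>A X. \<Union>x\<in>X. W +>\<^bsub>V\<^esub> act V A x)\<rparr>"

definition simple_sl_module :: "nat \<Rightarrow> 'v lie_rep \<Rightarrow> bool" where
  "simple_sl_module n V \<longleftrightarrow> sl_module n V \<and> carrier V \<noteq> {\<zero>\<^bsub>V\<^esub>} \<and>
     (\<forall>W. sl_submodule n V W \<longrightarrow> W = {\<zero>\<^bsub>V\<^esub>} \<or> W = carrier V)"

definition has_lowest_weight :: "nat \<Rightarrow> 'v lie_rep \<Rightarrow> (complex mat \<Rightarrow> complex) \<Rightarrow> bool" where
  "has_lowest_weight n V wt \<longleftrightarrow>
     (\<exists>v\<in>carrier V. v \<noteq> \<zero>\<^bsub>V\<^esub> \<and> (\<forall>H\<in>cartan n. act V H v = wt H \<odot>\<^bsub>V\<^esub> v) \<and>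
        (\<forall>A\<in>strictly_lower n. act V A v = \<zero>\<^bsub>V\<^esub>))"

text \<open>A monomial is an exponent vector \<^typ>\<open>nat \<Rightarrow>\<^sub>0 nat\<close>; addition of exponent vectors makes the
  product of \<open>cpoly\<close> the product of polynomials.\<close>

type_synonym cpoly = "(nat \<Rightarrow>\<^sub>0 nat) \<Rightarrow>\<^sub>0 complex"

definition pconst :: "complex \<Rightarrow> cpoly" where
  "pconst c = Poly_Mapping.single 0 c"

definition hvar :: "nat \<Rightarrow> cpoly" where
  "hvar k = Poly_Mapping.single (Poly_Mapping.single k 1) 1"

definition polys :: "nat \<Rightarrow> cpoly set" where
  "polys n = {p. \<forall>m\<in>Poly_Mapping.keys p. Poly_Mapping.keys m \<subseteq> {1..n}}"

definition Uh_ring :: "nat \<Rightarrow> cpoly ring" where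
  "Uh_ring n = \<lparr>carrier = polys n, mult = (*), one = 1, zero = 0, add = (+)\<rparr>"

definition poly_subst :: "(nat \<Rightarrow> cpoly) \<Rightarrow> cpoly \<Rightarrow> cpoly" where
  "poly_subst s p = (\<Sum>m\<in>Poly_Mapping.keys p.
     pconst (Poly_Mapping.lookup p m) * (\<Prod>k\<in>Poly_Mapping.keys m. s k ^ Poly_Mapping.lookup m k))"

text \<open>\<open>\<sigma>\<^sub>i\<close> is taken on polynomials in all the variables \<open>h\<^sub>k\<close>, where it is bijective as well.\<close>

definition sigma :: "nat \<Rightarrow> cpoly \<Rightarrow> cpoly" where
  "sigma i = poly_subst (\<lambda>k. hvar k - (if k = i then 1 else 0))"

definition hbar :: "nat \<Rightarrow> cpoly" where
  "hbar n = (\<Sum>k=1..n. hvar k)"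

text \<open>The enveloping algebra of the Cartan subalgebra is the polynomial algebra in the \<open>h\<^sub>k\<close>, so a
  module restricts to a module over \<open>Uh_ring n\<close> by letting \<open>hvar k\<close> act as \<open>h_mat n k\<close>. The operators
  commute, so the order of composition chosen in \<open>monom_act\<close> is irrelevant.\<close>

definition monom_act :: "nat \<Rightarrow> 'v lie_rep \<Rightarrow> (nat \<Rightarrow>\<^sub>0 nat) \<Rightarrow> 'v \<Rightarrow> 'v" where
  "monom_act n V m = fold (\<lambda>k. act V (h_mat n k) ^^ Poly_Mapping.lookup m k) [1..<Suc n]"

definition poly_act :: "nat \<Rightarrow> 'v lie_rep \<Rightarrow> cpoly \<Rightarrow> 'v \<Rightarrow> 'v" where
  "poly_act n V p v =
     (\<Oplus>\<^bsub>V\<^esub>m\<in>Poly_Mapping.keys p. Poly_Mapping.lookup p m \<odot>\<^bsub>V\<^esub> monom_act n V m v)"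

definition res_cartan :: "nat \<Rightarrow> 'v lie_rep \<Rightarrow> (cpoly, 'v) module" where
  "res_cartan n V =
     \<lparr>carrier = carrier V, mult = undefined, one = undefined, zero = \<zero>\<^bsub>V\<^esub>, add = add V,
      smult = poly_act n V\<rparr>"

definition finitely_generated :: "('a, 'b) ring_scheme \<Rightarrow> ('a, 'c, 'd) module_scheme \<Rightarrow> bool" where
  "finitely_generated R M \<longleftrightarrow>
     (\<exists>S. finite S \<and> S \<subseteq> carrier M \<and> LinearCombinations.module.span R M S = carrier M)"

definition free_of_rank ::
    "('a, 'b) ring_scheme \<Rightarrow> ('a, 'c, 'd) module_scheme \<Rightarrow> nat \<Rightarrow> bool" where
  "free_of_rank R M r \<longleftrightarrow>
     (\<exists>B. finite B \<and> card B = r \<and> B \<subseteq> carrier M \<and> \<not> LinearCombinations.module.lin_dep R M B \<and>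
        LinearCombinations.module.span R M B = carrier M)"

definition in_frakM :: "nat \<Rightarrow> 'v lie_rep \<Rightarrow> bool" where
  "in_frakM n V \<longleftrightarrow> sl_module n V \<and> finitely_generated (Uh_ring n) (res_cartan n V)"

definition in_calM :: "nat \<Rightarrow> 'v lie_rep \<Rightarrow> bool" where
  "in_calM n V \<longleftrightarrow> sl_module n V \<and> free_of_rank (Uh_ring n) (res_cartan n V) 1"

text \<open>Only meaningful for distinct \<open>i\<close> and \<open>j\<close> in \<open>{1..n+1}\<close>; the diagonal is treated in \<open>M_act\<close>.\<close>

definition M_unit :: "nat \<Rightarrow> complex \<Rightarrow> nat \<Rightarrow> nat \<Rightarrow> cpoly \<Rightarrow> cpoly" where
  "M_unit n b i j f =
     (if j = Suc n then (hbar n + pconst b) * sigma i f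
      else if i = Suc n then - (hvar j - pconst b) * inv_into UNIV (sigma j) f
      else (hvar j - pconst b) * sigma i (inv_into UNIV (sigma j) f))"

text \<open>Linear extension to all traceless matrices: a traceless diagonal matrix with diagonal
  entries \<open>d\<^sub>1, \<dots>, d\<^sub>n\<^sub>+\<^sub>1\<close> equals \<open>\<Sum>k=1..n. (d\<^sub>k - d\<^sub>n\<^sub>+\<^sub>1) h\<^sub>k\<close>.\<close>

definition M_act :: "nat \<Rightarrow> complex \<Rightarrow> complex mat \<Rightarrow> cpoly \<Rightarrow> cpoly" where
  "M_act n b A f =
     (\<Sum>i=1..Suc n. \<Sum>j\<in>{1..Suc n} - {i}. pconst (A $$ (i - 1, j - 1)) * M_unit n b i j f) +
     (\<Sum>k=1..n. pconst (A $$ (k - 1, k - 1) - A $$ (n, n)) * (hvar k * f))"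

definition M_rep :: "nat \<Rightarrow> complex \<Rightarrow> cpoly lie_rep" where
  "M_rep n b =
     \<lparr>carrier = polys n, mult = undefined, one = undefined, zero = 0, add = (+),
      smult = (\<lambda>c f. pconst c * f), act = M_act n b\<rparr>"

lemma sigma_hvar: "sigma i (hvar k) = hvar k - (if k = i then 1 else 0)"
  by (simp add: sigma_def poly_subst_def hvar_def pconst_def)

lemma pconst_simps [simp]: "pconst 0 = 0" "pconst 1 = 1"
  by (simp_all add: pconst_def)

lemma M_act_h_mat:
  assumes "k \<in> {1..n}"
  shows "M_act n b (h_mat n k) f = hvar k * f"
proof -
  have off: "h_mat n k $$ (i - 1, j - 1) = 0"
    if "i \<in> {1..Suc n}" "j \<in> {1..Suc n} - {i}" for i j
    using that by (auto simp: h_mat_def e_mat_def)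
  have diag: "h_mat n k $$ (l - 1, l - 1) - h_mat n k $$ (n, n) = (if l = k then 1 else 0)"
    if "l \<in> {1..n}" for l
    using that assms by (auto simp: h_mat_def e_mat_def)
  have "M_act n b (h_mat n k) f = (\<Sum>l=1..n. pconst (if l = k then 1 else 0) * (hvar l * f))"
    unfolding M_act_def by (simp only: off diag pconst_simps mult_zero_left sum.neutral_const
        add_0_left cong: sum.cong)
  also have "\<dots> = (\<Sum>l=1..n. if l = k then hvar l * f else 0)"
    by (rule sum.cong) auto
  also have "\<dots> = hvar k * f"
    using assms by simp
  finally show ?thesis .
qed

lemma M_act_e_mat:
  assumes ij: "i \<in> {1..Suc n}" "j \<in> {1..Suc n}" "i \<noteq> j"
  shows "M_act n b (e_mat n i j) f = M_unit n b i j f"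
proof -
  have off: "e_mat n i j $$ (i' - 1, j' - 1) = (if i' = i \<and> j' = j then 1 else 0)"
    if "i' \<in> {1..Suc n}" "j' \<in> {1..Suc n} - {i'}" for i' j'
    using that by (auto simp: e_mat_def)
  have diag: "e_mat n i j $$ (l - 1, l - 1) = 0" "e_mat n i j $$ (n, n) = 0"
    if "l \<in> {1..n}" for l
    using that ij by (auto simp: e_mat_def)
  have "M_act n b (e_mat n i j) f =
      (\<Sum>i'=1..Suc n. \<Sum>j'\<in>{1..Suc n} - {i'}.
         pconst (if i' = i \<and> j' = j then 1 else 0) * M_unit n b i' j' f)"
    unfolding M_act_def
    by (simp only: off diag pconst_simps mult_zero_left sum.neutral_const diff_self
        add_0_right cong: sum.cong)
  also have "\<dots> = (\<Sum>i'=1..Suc n. if i' = i then M_unit n b i j f else 0)"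
  proof (rule sum.cong[OF refl])
    fix i' assume "i' \<in> {1..Suc n}"
    have "(\<Sum>j'\<in>{1..Suc n} - {i'}. pconst (if i' = i \<and> j' = j then 1 else 0) * M_unit n b i' j' f)
        = (\<Sum>j'\<in>{1..Suc n} - {i'}. if j' = j then (if i' = i then M_unit n b i j f else 0) else 0)"
      by (rule sum.cong) auto
    also have "\<dots> = (if i' = i then M_unit n b i j f else 0)"
      using ij by (subst sum.delta) auto
    finally show "(\<Sum>j'\<in>{1..Suc n} - {i'}.
         pconst (if i' = i \<and> j' = j then 1 else 0) * M_unit n b i' j' f) =
      (if i' = i then M_unit n b i j f else 0)" .
  qed
  also have "\<dots> = M_unit n b i j f"
    using ij by (subst sum.delta) auto
  finally show ?thesis .
qed

end

theory Submission
  imports Defs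
begin

text \<open>Put \<open>N = (n + 1) b\<close>, \<open>x\<^sub>j = b - h\<^sub>j\<close> for \<open>j \<le> n\<close> and \<open>x\<^sub>n\<^sub>+\<^sub>1 = h\<^sub>1 + \<dots> + h\<^sub>n + b\<close>, so that
  \<open>x\<^sub>1 + \<dots> + x\<^sub>n\<^sub>+\<^sub>1 = N\<close>. Up to sign every \<open>e\<^sub>i\<^sub>j\<close> acts by \<open>f \<mapsto> x\<^sub>j f(x + \<epsilon>\<^sub>i - \<epsilon>\<^sub>j)\<close>, so the polynomials vanishing at
  the points of \<open>\<nat>\<^sup>n\<^sup>+\<^sup>1\<close> with coordinate sum \<open>N\<close> form a submodule \<open>W\<close>. It is spanned by the products
  of falling factorials in \<open>x\<^sub>1, \<dots>, x\<^sub>n\<close> of degree greater than \<open>N\<close>, and the products of degree at most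
  \<open>N\<close> give a basis of the quotient.

  A submodule is an ideal. If it contains \<open>f \<noteq> 0\<close>, taking differences shows that it contains the falling
  factorial of some order \<open>r \<le> deg f\<close> in \<open>x\<^sub>n\<^sub>+\<^sub>1\<close>, hence all products of falling factorials in
  \<open>x\<^sub>1, \<dots>, x\<^sub>n\<^sub>+\<^sub>1\<close> of total order \<open>r\<close>. Since the \<open>x\<^sub>j\<close> add up to \<open>N\<close>, those of order \<open>r - 1\<close> are combinations
  of these unless \<open>r = N + 1\<close>. So the submodule contains \<open>1\<close> if \<open>r \<le> N\<close>, and \<open>W\<close> if \<open>r > N\<close>; and an
  element outside \<open>W\<close> can be reduced modulo \<open>W\<close> to one of degree at most \<open>N\<close>.

  \<open>W\<close> is not principal for \<open>n \<ge> 2\<close>: a generator vanishes at the origin of the coordinates, where the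
  falling factorials of order \<open>N + 1\<close> in \<open>x\<^sub>1\<close> and in \<open>x\<^sub>2\<close> have independent differentials.\<close>

section \<open>Polynomials and substitutions\<close>

text \<open>One construction for two purposes: with the images of the monomials as \<open>g\<close>
  it is substitution, and with the falling factorial products \<open>P\<close> below it turns a
  coefficient vector, again encoded as an element of \<open>cpoly\<close>, into a
  polynomial.\<close>

definition lin_ext :: "('m \<Rightarrow> cpoly) \<Rightarrow> ('m \<Rightarrow>\<^sub>0 complex) \<Rightarrow> cpoly" where
  "lin_ext g p = (\<Sum>m\<in>Poly_Mapping.keys p. pconst (Poly_Mapping.lookup p m) * g m)"

lemma poly_subst_eq_lin_ext:
  "poly_subst s = lin_ext (\<lambda>m. \<Prod>k\<in>Poly_Mapping.keys m. s k ^ Poly_Mapping.lookup m k)"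
  by (simp add: fun_eq_iff poly_subst_def lin_ext_def)

lemma pconst_add: "pconst (a + b) = pconst a + pconst b"
  by (simp add: pconst_def single_add)

lemma pconst_mult: "pconst (a * b) = pconst a * pconst b"
  by (simp add: pconst_def mult_single)

interpretation pconst: comm_ring_hom pconst
  by unfold_locales (simp_all add: pconst_add pconst_mult)

lemma sum_single_eq: "(\<Sum>m\<in>Poly_Mapping.keys p. Poly_Mapping.single m (Poly_Mapping.lookup p m)) = p"
  for p :: "'m \<Rightarrow>\<^sub>0 'c::comm_monoid_add"
proof (rule poly_mapping_eqI)
  fix k
  have "(\<Sum>m\<in>Poly_Mapping.keys p. Poly_Mapping.lookup p m when m = k) = Poly_Mapping.lookup p k"
    by (cases "k \<in> Poly_Mapping.keys p")
      (simp_all add: when_def in_keys_iff)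
  then show "Poly_Mapping.lookup (\<Sum>m\<in>Poly_Mapping.keys p.
      Poly_Mapping.single m (Poly_Mapping.lookup p m)) k = Poly_Mapping.lookup p k"
    by (simp add: lookup_sum lookup_single)
qed

lemma prod_single_eq:
  "(\<Prod>k\<in>Poly_Mapping.keys m. hvar k ^ Poly_Mapping.lookup m k) = Poly_Mapping.single m 1"
proof -
  have pow: "hvar k ^ a = Poly_Mapping.single (Poly_Mapping.single k a) 1" for k a
    by (induction a) (simp_all add: hvar_def mult_single flip: single_add)
  have "(\<Prod>k\<in>K. Poly_Mapping.single (g k) 1) = Poly_Mapping.single (\<Sum>k\<in>K. g k) (1::complex)"
    for K and g :: "nat \<Rightarrow> (nat \<Rightarrow>\<^sub>0 nat)"
    by (induction K rule: infinite_finite_induct) (simp_all add: mult_single)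
  then show ?thesis by (simp add: pow sum_single_eq)
qed

lemma monomial_eq: "Poly_Mapping.single m c =
    pconst c * (\<Prod>k\<in>Poly_Mapping.keys m. hvar k ^ Poly_Mapping.lookup m k)"
  by (simp add: prod_single_eq pconst_def mult_single)

text \<open>The set \<open>K\<close> of admissible variables gives induction over all polynomials
  (\<open>K = UNIV\<close>) and over \<open>polys n\<close> (\<open>K = {1..n}\<close>) from one
  proof.\<close>

lemma polynomial_induct_on [consumes 1, case_names const var add mult]:
  assumes "\<forall>m\<in>Poly_Mapping.keys p. Poly_Mapping.keys m \<subseteq> K"
    and const: "\<And>c. P (pconst c)" and var: "\<And>k. k \<in> K \<Longrightarrow> P (hvar k)"
    and add: "\<And>p q. P p \<Longrightarrow> P q \<Longrightarrow> P (p + q)" and mult: "\<And>p q. P p \<Longrightarrow> P q \<Longrightarrow> P (p * q)"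
  shows "P p"
proof -
  have one: "P 1" using const[of 1] by simp
  have pow: "P (hvar k ^ a)" if "k \<in> K" for k a
    by (induction a) (auto intro: one mult var that)
  have prod: "P (\<Prod>k\<in>L. hvar k ^ g k)" if "L \<subseteq> K" for L g
    using that by (induction L rule: infinite_finite_induct) (simp_all add: one mult pow)
  have mono: "P (Poly_Mapping.single m c)" if "Poly_Mapping.keys m \<subseteq> K" for m c
    unfolding monomial_eq by (rule mult[OF const prod[OF that]])
  have "P (\<Sum>m\<in>A. Poly_Mapping.single m (Poly_Mapping.lookup p m))"
    if "A \<subseteq> Poly_Mapping.keys p" for A
    using that
  proof (induction A rule: infinite_finite_induct)
    case (insert m A)
    then show ?case using assms(1) by (simp add: add mono)
  qed (use const[of 0] in simp_all)
  from this[OF subset_refl] show ?thesis by (simp add: sum_single_eq)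
qed

lemma polynomial_induct [case_names const var add mult]:
  assumes "\<And>c. P (pconst c)" and "\<And>k. P (hvar k)"
    and "\<And>p q. P p \<Longrightarrow> P q \<Longrightarrow> P (p + q)" and "\<And>p q. P p \<Longrightarrow> P q \<Longrightarrow> P (p * q)"
  shows "P p"
  by (rule polynomial_induct_on[of p UNIV, OF _ assms(1,2) assms(3,4)]) simp_all

lemma polys_induct [consumes 1, case_names const var add mult]:
  assumes "p \<in> polys n"
    and "\<And>c. P (pconst c)" and "\<And>k. k \<in> {1..n} \<Longrightarrow> P (hvar k)"
    and "\<And>p q. P p \<Longrightarrow> P q \<Longrightarrow> P (p + q)" and "\<And>p q. P p \<Longrightarrow> P q \<Longrightarrow> P (p * q)"
  shows "P p"
  by (rule polynomial_induct_on[of p "{1..n}", OF _ assms(2-)]) (use assms(1) in \<open>simp_all add: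
      polys_def\<close>)

section \<open>Closure properties of \<open>polys n\<close>\<close>

lemma pconst_in_polys [simp]: "pconst c \<in> polys n"
  by (auto simp: polys_def pconst_def split: if_splits)

lemma zero_in_polys [simp]: "0 \<in> polys n" and one_in_polys [simp]: "1 \<in> polys n"
  using pconst_in_polys[of 0 n] pconst_in_polys[of 1 n] by simp_all

lemma hvar_in_polys [simp]: "hvar k \<in> polys n \<longleftrightarrow> k \<in> {1..n}"
  by (auto simp: polys_def hvar_def)

lemma add_in_polys [simp, intro]: "p \<in> polys n \<Longrightarrow> q \<in> polys n \<Longrightarrow> p + q \<in> polys n"
  using keys_add[of p q] by (fastforce simp: polys_def)

lemma mult_in_polys [simp, intro]:
  assumes "p \<in> polys n" "q \<in> polys n"
  shows "p * q \<in> polys n"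
  unfolding polys_def
proof (intro CollectI ballI)
  fix m assume "m \<in> Poly_Mapping.keys (p * q)"
  then obtain a b where "m = a + b" "a \<in> Poly_Mapping.keys p" "b \<in> Poly_Mapping.keys q"
    using keys_mult[of p q] by auto
  then show "Poly_Mapping.keys m \<subseteq> {1..n}"
    using assms keys_add[of a b] by (fastforce simp: polys_def)
qed

lemma uminus_in_polys [simp, intro]: "p \<in> polys n \<Longrightarrow> - p \<in> polys n"
  using mult_in_polys[OF pconst_in_polys[of "-1"]] by (simp add: pconst.hom_uminus)

lemma diff_in_polys [simp, intro]: "p \<in> polys n \<Longrightarrow> q \<in> polys n \<Longrightarrow> p - q \<in> polys n"
  using add_in_polys[of p n "- q"] by simp

lemma sum_in_polys [simp, intro]: "(\<And>x. x \<in> A \<Longrightarrow> f x \<in> polys n) \<Longrightarrow> sum f A \<in> polys n"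
  by (induction A rule: infinite_finite_induct) auto

lemma prod_in_polys [simp, intro]: "(\<And>x. x \<in> A \<Longrightarrow> f x \<in> polys n) \<Longrightarrow> prod f A \<in> polys n"
  by (induction A rule: infinite_finite_induct) auto

lemma hbar_in_polys [simp]: "hbar n \<in> polys n"
  by (auto simp: hbar_def)


section \<open>Substitution as a ring homomorphism\<close>

lemma lin_ext_superset:
  assumes "finite A" "Poly_Mapping.keys p \<subseteq> A"
  shows "lin_ext g p = (\<Sum>m\<in>A. pconst (Poly_Mapping.lookup p m) * g m)"
  unfolding lin_ext_def
  by (rule sum.mono_neutral_left) (use assms in \<open>auto simp: in_keys_iff\<close>)

lemma lin_ext_add: "lin_ext g (p + q) = lin_ext g p + lin_ext g q"
proof -
  let ?A = "Poly_Mapping.keys p \<union> Poly_Mapping.keys q"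
  have "lin_ext g (p + q) = (\<Sum>m\<in>?A. pconst (Poly_Mapping.lookup (p + q) m) * g m)"
    using keys_add[of p q] by (intro lin_ext_superset) auto
  then show ?thesis
    by (simp add: lin_ext_superset[of ?A] lookup_add pconst_add distrib_right sum.distrib)
qed

lemma lin_ext_single [simp]: "lin_ext g (Poly_Mapping.single m c) = pconst c * g m"
  by (subst lin_ext_superset[of "{m}"]) auto

lemma lin_ext_zero [simp]: "lin_ext g 0 = 0"
  by (simp add: lin_ext_def)

lemma lin_ext_sum: "lin_ext g (sum f A) = (\<Sum>x\<in>A. lin_ext g (f x))"
  by (induction A rule: infinite_finite_induct) (simp_all add: lin_ext_add)

lemma subst_monomial_mult:
  "poly_subst s (Poly_Mapping.single a c * Poly_Mapping.single b d) =
   poly_subst s (Poly_Mapping.single a c) * poly_subst s (Poly_Mapping.single b d)"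
proof -
  \<comment> \<open>A common index set for the exponents \<open>a\<close>, \<open>b\<close> and
    \<open>a + b\<close>; indices outside the keys contribute a factor 1.\<close>
  let ?K = "Poly_Mapping.keys a \<union> Poly_Mapping.keys b"
  have mono: "(\<Prod>k\<in>Poly_Mapping.keys m. s k ^ Poly_Mapping.lookup m k) =
      (\<Prod>k\<in>?K. s k ^ Poly_Mapping.lookup m k)" if "Poly_Mapping.keys m \<subseteq> ?K" for m
    by (rule prod.mono_neutral_left) (use that in \<open>auto simp: in_keys_iff\<close>)
  have "(\<Prod>k\<in>Poly_Mapping.keys (a + b). s k ^ Poly_Mapping.lookup (a + b) k) =
      (\<Prod>k\<in>?K. s k ^ Poly_Mapping.lookup (a + b) k)"
    by (rule mono) (rule keys_add)
  then show ?thesis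
    by (simp add: poly_subst_eq_lin_ext mult_single mono[of a] mono[of b] lookup_add power_add
        prod.distrib pconst_mult)
qed

interpretation subst: comm_ring_hom "poly_subst s" for s
proof
  show "poly_subst s 0 = 0" by (simp add: poly_subst_eq_lin_ext)
  show "poly_subst s 1 = 1"
    by (simp add: poly_subst_eq_lin_ext lin_ext_def)
  show add: "poly_subst s (p + q) = poly_subst s p + poly_subst s q" for p q
    by (simp add: poly_subst_eq_lin_ext lin_ext_add)
  have sum: "poly_subst s (sum f A) = (\<Sum>x\<in>A. poly_subst s (f x))" for f and A :: "'z set"
    by (simp add: poly_subst_eq_lin_ext lin_ext_sum)
  show "poly_subst s (p * q) = poly_subst s p * poly_subst s q" for p q
  proof -
    let ?t = "\<lambda>p m. Poly_Mapping.single m (Poly_Mapping.lookup p m) :: cpoly"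
    have "poly_subst s ((\<Sum>a\<in>Poly_Mapping.keys p. ?t p a) * (\<Sum>b\<in>Poly_Mapping.keys q. ?t q b)) =
        poly_subst s (\<Sum>a\<in>Poly_Mapping.keys p. ?t p a) * poly_subst s (\<Sum>b\<in>Poly_Mapping.keys q. ?t q
            b)"
      unfolding sum_product sum subst_monomial_mult ..
    then show ?thesis unfolding sum_single_eq .
  qed
qed

lemma poly_subst_pconst [simp]: "poly_subst s (pconst c) = pconst c"
  by (simp add: poly_subst_eq_lin_ext pconst_def)

lemma poly_subst_hvar [simp]: "poly_subst s (hvar k) = s k"
  by (simp add: poly_subst_eq_lin_ext hvar_def)

lemma pconst_of_nat: "pconst (of_nat k) = of_nat k"
  by (induction k) (simp_all add: pconst_add)

lemma pconst_eq_0_iff [simp]: "pconst c = 0 \<longleftrightarrow> c = 0"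
  by (metis lookup_single_eq lookup_zero pconst_def pconst_simps(1))

lemma poly_subst_comp: "poly_subst s (poly_subst t f) = poly_subst (\<lambda>k. poly_subst s (t k)) f"
  by (induction f rule: polynomial_induct) (simp_all add: hom_distribs)

text \<open>This identifies substitutions that differ only on variables outside
  \<open>{1..n}\<close>, such as \<open>sigma i\<close> and \<open>shift i (Suc n)\<close>.\<close>

lemma poly_subst_eq_on_polys:
  assumes "f \<in> polys n" "\<And>k. k \<in> {1..n} \<Longrightarrow> s k = t k"
  shows "poly_subst s f = poly_subst t f"
  using assms(1) by (induction rule: polys_induct) (use assms(2) in \<open>simp_all add: hom_distribs\<close>)

lemma poly_subst_hvar_eq [simp]: "poly_subst hvar f = f"
  by (induction f rule: polynomial_induct) (simp_all add: hom_distribs)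

lemma poly_subst_in_polys:
  assumes "f \<in> polys n" "\<And>k. k \<in> {1..n} \<Longrightarrow> s k \<in> polys n"
  shows "poly_subst s f \<in> polys n"
  using assms(1) by (induction rule: polys_induct) (use assms(2) in \<open>auto simp: hom_distribs\<close>)

section \<open>Shifts and falling factorials\<close>

text \<open>For distinct indices this is \<open>sigma i\<close> composed with the inverse of
  \<open>sigma j\<close>. The index \<open>Suc n\<close> moves only \<open>hvar (Suc n)\<close>,
  which does not occur in \<open>polys n\<close>, so \<open>sigma i\<close> and the inverse of
  \<open>sigma j\<close> are themselves instances there.\<close>

definition shift :: "nat \<Rightarrow> nat \<Rightarrow> cpoly \<Rightarrow> cpoly" where
  "shift i j = poly_subst (\<lambda>k. hvar k - of_bool (k = i) + of_bool (k = j))"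

interpretation shift: comm_ring_hom "shift i j" for i j
  unfolding shift_def by unfold_locales

lemma poly_subst_of_bool [simp]: "poly_subst s (of_bool P) = of_bool P"
  by (cases P) simp_all

lemma of_bool_in_polys [simp]: "of_bool P \<in> polys n"
  by (cases P) simp_all

lemma shift_pconst [simp]: "shift i j (pconst c) = pconst c"
  by (simp add: shift_def)

lemma shift_hvar: "shift i j (hvar k) = hvar k - of_bool (k = i) + of_bool (k = j)"
  by (simp add: shift_def)

lemma shift_in_polys [simp, intro]: "f \<in> polys n \<Longrightarrow> shift i j f \<in> polys n"
  unfolding shift_def by (rule poly_subst_in_polys) auto

lemma shift_comp: "shift i j (shift k l f) = poly_subst
    (\<lambda>t. hvar t - of_bool (t = k) + of_bool (t = l) - of_bool (t = i) + of_bool (t = j)) f"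
  unfolding shift_def poly_subst_comp by (simp add: hom_distribs algebra_simps)

lemma shift_commute: "shift i j (shift k l f) = shift k l (shift i j f)"
  unfolding shift_comp by (simp add: algebra_simps)

lemma shift_shift_same [simp]: "shift i j (shift k i f) = shift k j f"
  unfolding shift_comp by (simp add: shift_def)

lemma shift_same [simp]: "shift i i f = f"
  unfolding shift_def by simp

lemma inv_sigma: "inv_into UNIV (sigma j) f = poly_subst (\<lambda>k. hvar k + of_bool (k = j)) f"
proof (rule inv_f_eq)
  have "poly_subst (\<lambda>k. hvar k + of_bool (k = j)) (sigma j f) = f" for f
  proof -
    have "(\<lambda>k. poly_subst (\<lambda>k. hvar k + of_bool (k = j)) (hvar k - (if k = j then 1 else 0))) =
        hvar"
      by (auto simp: fun_eq_iff hom_distribs)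
    then show ?thesis by (simp add: sigma_def poly_subst_comp)
  qed
  then show "inj (sigma j)" by (metis injI)
  have "(\<lambda>k. poly_subst (\<lambda>k. hvar k - (if k = j then 1 else 0)) (hvar k + of_bool (k = j))) = hvar"
    by (auto simp: fun_eq_iff hom_distribs)
  then show "sigma j (poly_subst (\<lambda>k. hvar k + of_bool (k = j)) f) = f"
    by (simp add: sigma_def poly_subst_comp)
qed

fun ffact :: "'a::comm_ring_1 \<Rightarrow> nat \<Rightarrow> 'a" where
  "ffact x 0 = 1"
| "ffact x (Suc k) = ffact x k * (x - of_nat k)"

lemma ffact_Suc_left: "ffact (x + 1) (Suc k) = (x + 1) * ffact x k"
  by (induction k) (simp_all add: algebra_simps)

text \<open>The forward difference acts on falling factorials as the derivative acts on powers. This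
  lowers degrees in \<open>shift_P_difference\<close> and isolates \<open>q s\<close> in
  \<open>levelI_q\<close>.\<close>

lemma ffact_plus_one: "ffact (x + 1) (Suc k) = ffact x (Suc k) + of_nat (Suc k) * ffact x k"
  unfolding ffact_Suc_left by (simp add: algebra_simps)

text \<open>The factor \<open>a - a\<close> occurs among the first \<open>k\<close> factors exactly
  when \<open>a < k\<close>, and in an integral domain of characteristic 0 no other factor
  vanishes.\<close>

lemma ffact_of_nat_eq_0_iff:
  "ffact (of_nat a) k = (0::'a::{idom,ring_char_0}) \<longleftrightarrow> a < k"
  by (induction k) (auto simp: less_Suc_eq)

lemma (in comm_ring_hom) hom_ffact: "hom (ffact x k) = ffact (hom x) k"
  by (induction k) (simp_all add: hom_distribs)

lemma ffact_in_polys [simp, intro]: "x \<in> polys n \<Longrightarrow> ffact x k \<in> polys n"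
  by (induction k) (auto simp flip: pconst_of_nat)

section \<open>Exponent vectors\<close>

definition exponents :: "nat \<Rightarrow> (nat \<Rightarrow>\<^sub>0 nat) set" where
  "exponents n = {m. Poly_Mapping.keys m \<subseteq> {1..n}}"

lemma polys_iff_keys: "p \<in> polys n \<longleftrightarrow> Poly_Mapping.keys p \<subseteq> exponents n"
  by (auto simp: polys_def exponents_def)

lemma zero_in_exponents [simp]: "0 \<in> exponents n"
  by (simp add: exponents_def)

lemma add_single_in_exponents [simp, intro]:
  "m \<in> exponents n \<Longrightarrow> k \<in> {1..n} \<Longrightarrow> m + Poly_Mapping.single k a \<in> exponents n"
  using keys_add[of m "Poly_Mapping.single k a"]
  by (force simp: exponents_def split: if_splits)

definition tdeg :: "nat \<Rightarrow> (nat \<Rightarrow>\<^sub>0 nat) \<Rightarrow> nat" where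
  "tdeg n m = (\<Sum>j=1..n. Poly_Mapping.lookup m j)"

lemma tdeg_zero [simp]: "tdeg n 0 = 0"
  by (simp add: tdeg_def)

lemma tdeg_add_single [simp]: "k \<in> {1..n} \<Longrightarrow> tdeg n (m + Poly_Mapping.single k a) = tdeg n m + a"
  by (simp add: tdeg_def lookup_add sum.distrib lookup_single when_def)

lemma exponents_eqI:
  assumes "m \<in> exponents n" "m' \<in> exponents n"
    and "\<And>j. j \<in> {1..n} \<Longrightarrow> Poly_Mapping.lookup m j = Poly_Mapping.lookup m' j"
  shows "m = m'"
proof (rule poly_mapping_eqI)
  fix j
  have "Poly_Mapping.lookup m j = 0" if "j \<notin> {1..n}" "m \<in> exponents n" for m
    using that unfolding exponents_def by (metis in_keys_iff mem_Collect_eq subsetD)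
  then show "Poly_Mapping.lookup m j = Poly_Mapping.lookup m' j"
    using assms by metis
qed

lemma exponents_remove_single:
  assumes "m \<in> exponents n" "Poly_Mapping.lookup m k > 0"
  obtains m' where "m' \<in> exponents n" "k \<in> {1..n}" "m = m' + Poly_Mapping.single k 1"
proof
  show k: "k \<in> {1..n}"
    using assms by (metis (mono_tags) exponents_def gr_implies_not0 in_keys_iff mem_Collect_eq
        subsetD)
  show *: "m = (m - Poly_Mapping.single k 1) + Poly_Mapping.single k 1"
    by (rule poly_mapping_eqI)
      (use assms in \<open>auto simp: lookup_add lookup_minus lookup_single when_def\<close>)
  show "m - Poly_Mapping.single k 1 \<in> exponents n"
    using assms(1) by (auto simp: exponents_def in_keys_iff lookup_minus)
qed

lemma exponents_induct [consumes 1, case_names zero add]: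
  assumes "m \<in> exponents n" "P 0"
    and "\<And>m k. m \<in> exponents n \<Longrightarrow> k \<in> {1..n} \<Longrightarrow> P m \<Longrightarrow> P (m + Poly_Mapping.single k 1)"
  shows "P m"
  using assms(1)
proof (induction "tdeg n m" arbitrary: m rule: less_induct)
  case less
  show ?case
  proof (cases "m = 0")
    case False
    then obtain k where "Poly_Mapping.lookup m k > 0"
      by (auto simp: poly_mapping_eq_iff fun_eq_iff)
    then obtain m' where m': "m' \<in> exponents n" "k \<in> {1..n}" "m = m' + Poly_Mapping.single k 1"
      using less.prems exponents_remove_single by blast
    then have "P m'" using less.hyps[of m'] by simp
    then show ?thesis unfolding m'(3) by (rule assms(3)[OF m'(1,2)])
  qed (use assms(2) in simp)
qed

lemma exponents_tdeg_0: "m \<in> exponents n \<Longrightarrow> tdeg n m = 0 \<Longrightarrow> m = 0"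
  by (rule exponents_eqI[of _ n]) (auto simp: tdeg_def)

section \<open>Evaluation at integral points\<close>

text \<open>The point has coordinates x_k = m_k, that is h_k = b - m_k. The value is kept as a
  constant polynomial, so evaluation is again a substitution homomorphism.\<close>

definition ev :: "complex \<Rightarrow> (nat \<Rightarrow>\<^sub>0 nat) \<Rightarrow> cpoly \<Rightarrow> cpoly" where
  "ev b m = poly_subst (\<lambda>k. pconst (b - of_nat (Poly_Mapping.lookup m k)))"

interpretation ev: comm_ring_hom "ev b m" for b m
  unfolding ev_def by unfold_locales

lemma ev_pconst [simp]: "ev b m (pconst c) = pconst c"
  by (simp add: ev_def)

section \<open>Coordinates and the falling factorial basis\<close>

lemma sum_of_bool_eq: "(\<Sum>k\<in>A. of_bool (k = i)) = (of_bool (finite A \<and> i \<in> A) :: 'a::semiring_1)"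
  by (cases "finite A") (auto simp: of_bool_def)

locale weight_module =
  fixes n :: nat and b :: complex and N :: nat
  assumes n_pos: "n \<ge> 1" and N_eq: "of_nat (n + 1) * b = of_nat N"
begin

text \<open>In the coordinates \<open>x j\<close>, whose sum is \<open>N\<close>, the matrix unit \<open>e\<^sub>i\<^sub>j\<close> acts up to sign by the
  formula \<open>x j * shift i j f\<close>, uniformly in \<open>i\<close> and \<open>j\<close>.\<close>

definition x :: "nat \<Rightarrow> cpoly" where
  "x j = (if j = Suc n then hbar n + pconst b else pconst b - hvar j)"

lemma x_in_polys [simp]: "j \<in> {1..Suc n} \<Longrightarrow> x j \<in> polys n"
  by (auto simp: x_def)

lemma sum_x: "(\<Sum>j=1..Suc n. x j) = of_nat N"
proof -
  have "(\<Sum>j=1..Suc n. x j) = (\<Sum>j=1..n. pconst b - hvar j) + (hbar n + pconst b)"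
    by (auto simp: x_def intro!: sum.cong)
  also have "\<dots> = pconst (of_nat (n + 1) * b)"
    by (simp add: hbar_def sum_subtractf pconst_add pconst_mult pconst_of_nat algebra_simps)
  finally show ?thesis by (simp only: N_eq pconst_of_nat)
qed

lemma shift_x:
  assumes "i \<in> {1..Suc n}" "j \<in> {1..Suc n}" "l \<in> {1..Suc n}"
  shows "shift i j (x l) = x l + of_bool (l = i) - of_bool (l = j)"
proof (cases "l = Suc n")
  case True
  have "shift i j (hbar n) = hbar n - of_bool (i \<in> {1..n}) + of_bool (j \<in> {1..n})"
    by (simp add: hbar_def hom_distribs shift_hvar sum.distrib sum_subtractf sum_of_bool_eq)
  then show ?thesis using assms True by (auto simp: x_def hom_distribs)
next
  case False
  then show ?thesis by (auto simp: x_def shift_hvar hom_distribs)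
qed

text \<open>On \<open>polys n\<close> each \<open>sigma i\<close> and each inverse of
  \<open>sigma j\<close> is a shift with partner index \<open>Suc n\<close>, so the three defining
  formulas merge. The sign is that of \<open>h_j - b\<close> against \<open>x j\<close>, and it is +
  exactly when one index is \<open>Suc n\<close>.\<close>

lemma M_unit_eq:
  assumes "f \<in> polys n" "i \<in> {1..Suc n}" "j \<in> {1..Suc n}" "i \<noteq> j"
  shows "M_unit n b i j f = (if i = Suc n \<or> j = Suc n then 1 else - 1) * (x j * shift i j f)"
proof -
  have 1: "sigma i f = shift i (Suc n) f"
    unfolding sigma_def shift_def
    by (rule poly_subst_eq_on_polys[OF assms(1)]) auto
  have 2: "inv_into UNIV (sigma j) f = shift (Suc n) j f"
    unfolding inv_sigma shift_def
    by (rule poly_subst_eq_on_polys[OF assms(1)]) auto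
  have 3: "sigma i (shift (Suc n) j f) = shift i j f"
    unfolding sigma_def shift_def poly_subst_comp
    by (rule poly_subst_eq_on_polys[OF assms(1)]) (auto simp: hom_distribs)
  show ?thesis using assms(2-) by (auto simp: M_unit_def 1 2 3 x_def algebra_simps)
qed

text \<open>A multivariate Newton basis: unlike a monomial, \<open>P m\<close> vanishes at every
  integral point that does not dominate \<open>m\<close> coordinatewise, which makes evaluation
  triangular.\<close>

definition P :: "(nat \<Rightarrow>\<^sub>0 nat) \<Rightarrow> cpoly" where
  "P m = (\<Prod>j=1..n. ffact (x j) (Poly_Mapping.lookup m j))"

lemma P_zero [simp]: "P 0 = 1"
  by (simp add: P_def)

lemma P_in_polys [simp, intro]: "P m \<in> polys n"
  by (auto simp: P_def)

lemma P_add_single: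
  assumes "k \<in> {1..n}"
  shows "P (m + Poly_Mapping.single k 1) = (x k - of_nat (Poly_Mapping.lookup m k)) * P m"
proof -
  have "P (m + Poly_Mapping.single k 1) =
      (\<Prod>j=1..n. (if j = k then x k - of_nat (Poly_Mapping.lookup m k) else 1) *
        ffact (x j) (Poly_Mapping.lookup m j))"
    unfolding P_def by (rule prod.cong) (auto simp: lookup_add lookup_single when_def)
  also have "\<dots> = (x k - of_nat (Poly_Mapping.lookup m k)) * P m"
    using assms by (simp add: prod.distrib P_def)
  finally show ?thesis .
qed

end

section \<open>Ideals of the polynomial ring and expansions in falling factorials\<close>

text \<open>Closure is required only under constants and the generators h_k, because this is what a
  submodule provides directly. \<open>Uh_ideal_mult\<close> recovers all of
  \<open>polys n\<close>.\<close>

definition Uh_ideal :: "nat \<Rightarrow> cpoly set \<Rightarrow> bool" where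
  "Uh_ideal n I \<longleftrightarrow> I \<subseteq> polys n \<and> 0 \<in> I \<and> (\<forall>f\<in>I. \<forall>g\<in>I. f + g \<in> I) \<and>
     (\<forall>c. \<forall>f\<in>I. pconst c * f \<in> I) \<and> (\<forall>k\<in>{1..n}. \<forall>f\<in>I. hvar k * f \<in> I)"

lemma Uh_ideal_mult:
  assumes "Uh_ideal n I" "p \<in> polys n" "f \<in> I"
  shows "p * f \<in> I"
proof -
  have "\<forall>f\<in>I. p * f \<in> I" using assms(2)
    by (induction rule: polys_induct)
      (use assms(1) in \<open>auto simp: Uh_ideal_def distrib_right mult.assoc\<close>)
  then show ?thesis using assms(3) by blast
qed

lemma Uh_idealD:
  assumes "Uh_ideal n I"
  shows "f \<in> I \<Longrightarrow> f \<in> polys n" "0 \<in> I" "f \<in> I \<Longrightarrow> g \<in> I \<Longrightarrow> f + g \<in> I"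
  using assms by (auto simp: Uh_ideal_def)

lemma Uh_ideal_scale: "Uh_ideal n I \<Longrightarrow> f \<in> I \<Longrightarrow> pconst c * f \<in> I"
  by (simp add: Uh_ideal_def)

lemma Uh_ideal_diff:
  assumes "Uh_ideal n I" "f \<in> I" "g \<in> I"
  shows "f - g \<in> I"
  using Uh_ideal_mult[OF assms(1), of "- 1" g] assms by (auto simp: Uh_ideal_def)

lemma Uh_ideal_sum:
  assumes "Uh_ideal n I" "\<And>a. a \<in> A \<Longrightarrow> f a \<in> I"
  shows "sum f A \<in> I"
  using assms(2) by (induction A rule: infinite_finite_induct) (use assms(1) in \<open>auto simp:
      Uh_ideal_def\<close>)

lemma Uh_ideal_pconst_cancel:
  assumes "Uh_ideal n I" "pconst c * f \<in> I" "c \<noteq> 0"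
  shows "f \<in> I"
proof -
  have "f = pconst (1 / c) * (pconst c * f)"
    using assms(3) by (simp flip: mult.assoc pconst_mult)
  then show ?thesis using assms(1,2) by (metis Uh_ideal_def)
qed

lemma Uh_ideal_eq_polys:
  assumes "Uh_ideal n I" "1 \<in> I"
  shows "I = polys n"
  using Uh_ideal_mult[OF assms(1) _ assms(2)] assms(1) by (auto simp: Uh_ideal_def)

context weight_module
begin

lemma lin_ext_P_in_polys [simp, intro]: "lin_ext P c \<in> polys n"
  by (auto simp: lin_ext_def)

text \<open>The right-hand side is an ideal containing 1: \<open>P_add_single\<close> writes x_k
  \<open>P m\<close> as \<open>P\<close> of the raised exponent plus m_k \<open>P m\<close>, and h_k
  = b - x_k.\<close>

lemma polys_eq_lin_ext_P: "polys n = lin_ext P ` polys n" (is "_ = ?E")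
proof -
  have mono: "pconst c * P m \<in> ?E" if "m \<in> exponents n" for c m
    by (rule image_eqI[of _ _ "Poly_Mapping.single m c"]) (use that in \<open>auto simp: polys_iff_keys\<close>)
  have zero: "0 \<in> ?E" by (rule image_eqI[of _ _ 0]) auto
  have add: "f + g \<in> ?E" if "f \<in> ?E" "g \<in> ?E" for f g
    using that by (auto simp flip: lin_ext_add)
  have sum: "sum f A \<in> ?E" if "\<And>a. a \<in> A \<Longrightarrow> f a \<in> ?E" for f and A :: "(nat \<Rightarrow>\<^sub>0 nat) set"
    using that by (induction A rule: infinite_finite_induct) (auto simp: zero intro: add)
  have "pconst a * f \<in> ?E" if "f \<in> ?E" for a f
  proof -
    from that obtain c where c: "c \<in> polys n" "f = lin_ext P c" by auto
    have "pconst a * f = (\<Sum>m\<in>Poly_Mapping.keys c. pconst (a * Poly_Mapping.lookup c m) * P m)"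
      by (simp add: c lin_ext_def sum_distrib_left pconst_mult mult.assoc)
    also have "\<dots> \<in> ?E" using c by (intro sum mono) (auto simp: polys_iff_keys)
    finally show ?thesis .
  qed
  moreover have "hvar k * f \<in> ?E" if k: "k \<in> {1..n}" and "f \<in> ?E" for k f
  proof -
    from that obtain c where c: "c \<in> polys n" "f = lin_ext P c" by auto
    have hvar_P: "hvar k * P m = pconst (b - of_nat (Poly_Mapping.lookup m k)) * P m +
        pconst (- 1) * P (m + Poly_Mapping.single k 1)" for m
      using P_add_single[OF k, of m] k by (simp add: x_def hom_distribs pconst_of_nat algebra_simps)
    have summand: "pconst a * (hvar k * P m) =
        pconst (a * (b - of_nat (Poly_Mapping.lookup m k))) * P m +
        pconst (- a) * P (m + Poly_Mapping.single k 1)" for a m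
      unfolding hvar_P by (simp add: hom_distribs algebra_simps)
    have "hvar k * f = (\<Sum>m\<in>Poly_Mapping.keys c. pconst (Poly_Mapping.lookup c m) * (hvar k * P m))"
      by (simp add: c lin_ext_def sum_distrib_left mult.left_commute[of "hvar k"])
    also have "\<dots> \<in> ?E"
      unfolding summand
    proof (rule sum)
      fix m assume "m \<in> Poly_Mapping.keys c"
      then have "m \<in> exponents n" using c(1) by (auto simp: polys_iff_keys)
      then show "pconst (Poly_Mapping.lookup c m * (b - of_nat (Poly_Mapping.lookup m k))) * P m +
        pconst (- Poly_Mapping.lookup c m) * P (m + Poly_Mapping.single k 1) \<in> ?E"
        using k by (intro add mono add_single_in_exponents)
    qed
    finally show ?thesis .
  qed
  ultimately have "Uh_ideal n ?E" using zero add by (auto simp: Uh_ideal_def)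
  moreover have "1 \<in> ?E" using mono[of 0 1] by simp
  ultimately show ?thesis using Uh_ideal_eq_polys by metis
qed

text \<open>The last coordinate is forced by \<open>sum_x\<close>. Hence the exponents with
  \<open>tdeg n m\<close> at most \<open>N\<close> stand for the points with n + 1 nonnegative
  integer coordinates and sum \<open>N\<close>.\<close>

lemma ev_x:
  assumes "j \<in> {1..Suc n}" "m \<in> exponents n"
  shows "ev b m (x j) = (if j = Suc n then of_nat N - of_nat (tdeg n m) else of_nat
      (Poly_Mapping.lookup m j))"
proof -
  have *: "ev b m (x j) = of_nat (Poly_Mapping.lookup m j)" if "j \<noteq> Suc n" for j
    using that by (simp add: x_def ev_def hom_distribs pconst_of_nat)
  have "ev b m (\<Sum>j=1..Suc n. x j) = of_nat N" by (simp only: sum_x ev.hom_of_nat)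
  then have "(\<Sum>j=1..n. ev b m (x j)) + ev b m (x (Suc n)) = of_nat N" by (simp add: hom_distribs)
  moreover have "(\<Sum>j=1..n. ev b m (x j)) = of_nat (tdeg n m)" by (simp add: * tdeg_def)
  ultimately show ?thesis using * by (auto simp: algebra_simps)
qed

lemma ev_P: "ev b m (P m') = (\<Prod>j=1..n. ffact (of_nat (Poly_Mapping.lookup m j))
    (Poly_Mapping.lookup m' j))"
proof -
  have "ev b m (x j) = of_nat (Poly_Mapping.lookup m j)" if "j \<in> {1..n}" for j
    using that by (simp add: x_def ev_def hom_distribs pconst_of_nat)
  then show ?thesis by (simp add: P_def hom_distribs ev.hom_ffact)
qed

lemma ev_P_eq_0_iff: "ev b m (P m') = 0 \<longleftrightarrow> (\<exists>j\<in>{1..n}. Poly_Mapping.lookup m j <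
    Poly_Mapping.lookup m' j)"
  unfolding ev_P by (simp add: ffact_of_nat_eq_0_iff)

lemma ev_P_same: "ev b m (P m) \<noteq> 0"
  by (simp add: ev_P_eq_0_iff)

text \<open>A nonzero value forces \<open>m\<close> to dominate \<open>m'\<close> coordinatewise,
  and then \<open>tdeg n m\<close> at most \<open>tdeg n m'\<close> leaves only equality.\<close>

lemma ev_P_0:
  assumes "m \<in> exponents n" "m' \<in> exponents n" "tdeg n m \<le> tdeg n m'" "m \<noteq> m'"
  shows "ev b m (P m') = 0"
proof (rule ccontr)
  assume "ev b m (P m') \<noteq> 0"
  then have le: "Poly_Mapping.lookup m' j \<le> Poly_Mapping.lookup m j" if "j \<in> {1..n}" for j
    using that by (auto simp: ev_P_eq_0_iff not_less)
  have "Poly_Mapping.lookup m j = Poly_Mapping.lookup m' j" if "j \<in> {1..n}" for j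
  proof (rule ccontr)
    assume "\<not> ?thesis"
    then have "tdeg n m' < tdeg n m" unfolding tdeg_def
      using le that by (intro sum_strict_mono_ex1) (auto intro!: bexI[of _ j] simp:
          order.strict_iff_order)
    then show False using assms by simp
  qed
  then show False using assms exponents_eqI by blast
qed

text \<open>Triangularity: evaluate at a key \<open>m\<close> of least degree. By
  \<open>ev_P_0\<close> every other term dies there, so the value is the nonzero coefficient at
  \<open>m\<close> times a nonzero number. This serves both to describe \<open>W\<close> and to
  prove independence modulo \<open>W\<close>.\<close>

lemma lin_ext_P_vanishing:
  assumes c: "c \<in> polys n" and v: "\<And>m. m \<in> exponents n \<Longrightarrow> tdeg n m \<le> d \<Longrightarrow> ev b m (lin_ext P c) = 0"
    and "m0 \<in> Poly_Mapping.keys c"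
  shows "tdeg n m0 > d"
proof (rule ccontr)
  assume m0: "\<not> tdeg n m0 > d"
  obtain m where m: "m \<in> Poly_Mapping.keys c" "\<And>m'. m' \<in> Poly_Mapping.keys c \<Longrightarrow> tdeg n m \<le> tdeg n m'"
    using ex_has_least_nat[of "\<lambda>m. m \<in> Poly_Mapping.keys c" _ "tdeg n"] assms(3) by blast
  have ex: "Poly_Mapping.keys c \<subseteq> exponents n" using c by (simp add: polys_iff_keys)
  have "ev b m (lin_ext P c) = (\<Sum>m'\<in>Poly_Mapping.keys c. pconst (Poly_Mapping.lookup c m') * ev b
      m (P m'))"
    by (simp add: lin_ext_def hom_distribs)
  also have "\<dots> = (\<Sum>m'\<in>Poly_Mapping.keys c. if m' = m then pconst (Poly_Mapping.lookup c m) * ev b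
      m (P m) else 0)"
    by (rule sum.cong) (use m ex in \<open>auto intro!: ev_P_0\<close>)
  also have "\<dots> = pconst (Poly_Mapping.lookup c m) * ev b m (P m)" using m by simp
  also have "\<dots> \<noteq> 0" using m ev_P_same by (simp add: in_keys_iff)
  finally show False using v[of m] m m0 assms(3) ex by (meson le_trans not_le subsetD)
qed

definition W :: "cpoly set" where
  "W = {f \<in> polys n. \<forall>m\<in>exponents n. tdeg n m \<le> N \<longrightarrow> ev b m f = 0}"

lemma P_in_W:
  assumes "m \<in> exponents n" "tdeg n m > N"
  shows "P m \<in> W"
  unfolding W_def using assms by (auto intro!: ev_P_0)

text \<open>Evaluating a shift at \<open>m\<close> means evaluating at the neighbour m + e_i - e_j.
  The relation is stated additively to avoid truncated subtraction, and only for \<open>k\<close> up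
  to \<open>n\<close>, so that an index \<open>Suc n\<close> changes nothing.\<close>

lemma ev_shift:
  assumes "f \<in> polys n" "m' \<in> exponents n"
    and "\<And>k. k \<in> {1..n} \<Longrightarrow> Poly_Mapping.lookup m' k + of_bool (k = j) = Poly_Mapping.lookup m k +
        of_bool (k = i)"
  shows "ev b m (shift i j f) = ev b m' f"
  unfolding ev_def shift_def poly_subst_comp
proof (rule poly_subst_eq_on_polys[OF assms(1)])
  fix k assume "k \<in> {1..n}"
  from assms(3)[OF this]
  have "of_nat (Poly_Mapping.lookup m' k) + of_bool (k = j) = (of_nat (Poly_Mapping.lookup m k) +
      of_bool (k = i) :: complex)"
    by (metis of_nat_add of_nat_of_bool)
  then have *: "b - of_nat (Poly_Mapping.lookup m k) - of_bool (k = i) + of_bool (k = j) =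
      b - of_nat (Poly_Mapping.lookup m' k)" by (simp add: algebra_simps)
  have "pconst (of_bool Q) = of_bool Q" for Q by (cases Q) simp_all
  then have "poly_subst (\<lambda>k. pconst (b - of_nat (Poly_Mapping.lookup m k)))
      (hvar k - of_bool (k = i) + of_bool (k = j)) =
    pconst (b - of_nat (Poly_Mapping.lookup m k) - of_bool (k = i) + of_bool (k = j))"
    by (simp add: hom_distribs)
  then show "poly_subst (\<lambda>k. pconst (b - of_nat (Poly_Mapping.lookup m k)))
      (hvar k - of_bool (k = i) + of_bool (k = j)) =
    pconst (b - of_nat (Poly_Mapping.lookup m' k))"
    unfolding * .
qed

end

section \<open>The commutation relations\<close>

lemma vectorspaceI_complex:
  fixes V :: "(complex, 'v, 'c) module_scheme" (structure)
  assumes "abelian_group V"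
    and "\<And>c v. v \<in> carrier V \<Longrightarrow> c \<odot> v \<in> carrier V"
    and "\<And>c d v. v \<in> carrier V \<Longrightarrow> (c + d) \<odot> v = c \<odot> v \<oplus> d \<odot> v"
    and "\<And>c v w. v \<in> carrier V \<Longrightarrow> w \<in> carrier V \<Longrightarrow> c \<odot> (v \<oplus> w) = c \<odot> v \<oplus> c \<odot> w"
    and "\<And>c d v. v \<in> carrier V \<Longrightarrow> (c * d) \<odot> v = c \<odot> (d \<odot> v)"
    and "\<And>v. v \<in> carrier V \<Longrightarrow> 1 \<odot> v = v"
  shows "vectorspace (class_ring :: complex ring) V"
proof -
  have "module (class_ring :: complex ring) V"
  proof (rule Module.module.intro)
    show "cring (class_ring :: complex ring)" by unfold_locales
    show "module_axioms (class_ring :: complex ring) V"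
      by (rule Module.module_axioms.intro) (use assms in simp_all)
  qed (rule assms(1))
  then show ?thesis by (simp add: vectorspace_def class_field)
qed

lemma sum_swap4: "(\<Sum>i\<in>A. \<Sum>j\<in>B. \<Sum>k\<in>C. \<Sum>l\<in>D. h i j k l) =
    (\<Sum>k\<in>C. \<Sum>l\<in>D. \<Sum>i\<in>A. \<Sum>j\<in>B. h i j k l)"
proof -
  have "(\<Sum>i\<in>A. \<Sum>j\<in>B. \<Sum>k\<in>C. \<Sum>l\<in>D. h i j k l) = (\<Sum>i\<in>A. \<Sum>k\<in>C. \<Sum>j\<in>B. \<Sum>l\<in>D. h i j k l)"
    by (rule sum.cong[OF refl], rule sum.swap)
  also have "\<dots> = (\<Sum>k\<in>C. \<Sum>i\<in>A. \<Sum>j\<in>B. \<Sum>l\<in>D. h i j k l)"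
    by (rule sum.swap)
  also have "\<dots> = (\<Sum>k\<in>C. \<Sum>i\<in>A. \<Sum>l\<in>D. \<Sum>j\<in>B. h i j k l)"
    by (rule sum.cong[OF refl], rule sum.cong[OF refl], rule sum.swap)
  also have "\<dots> = (\<Sum>k\<in>C. \<Sum>l\<in>D. \<Sum>i\<in>A. \<Sum>j\<in>B. h i j k l)"
    by (rule sum.cong[OF refl], rule sum.swap)
  finally show ?thesis .
qed

text \<open>The Kronecker deltas in the commutators of matrix units collapse the fourfold sum to the
  entries of two matrix products.\<close>

lemma sum_commutator:
  fixes \<alpha> \<gamma> Y :: "'i \<Rightarrow> 'i \<Rightarrow> 'a::comm_ring_1"
  assumes I: "finite I"
  shows "(\<Sum>i\<in>I. \<Sum>j\<in>I. \<Sum>k\<in>I. \<Sum>l\<in>I. \<alpha> i j * \<gamma> k l *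
      (of_bool (i = l) * Y k j - of_bool (k = j) * Y i l)) =
    (\<Sum>i\<in>I. \<Sum>j\<in>I. ((\<Sum>k\<in>I. \<gamma> i k * \<alpha> k j) - (\<Sum>k\<in>I. \<alpha> i k * \<gamma> k j)) * Y i j)"
proof -
  have "(\<Sum>i\<in>I. \<Sum>j\<in>I. \<Sum>k\<in>I. \<Sum>l\<in>I. \<alpha> i j * \<gamma> k l * of_bool (i = l) * Y k j) =
      (\<Sum>i\<in>I. \<Sum>j\<in>I. \<Sum>k\<in>I. \<Sum>l\<in>I. if i = l then \<alpha> i j * \<gamma> k l * Y k j else 0)"
    by (intro sum.cong) auto
  also have "\<dots> = (\<Sum>i\<in>I. \<Sum>j\<in>I. \<Sum>k\<in>I. \<gamma> k i * \<alpha> i j * Y k j)"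
    by (intro sum.cong refl) (simp add: I mult.commute)
  also have "\<dots> = (\<Sum>i\<in>I. \<Sum>k\<in>I. \<Sum>j\<in>I. \<gamma> k i * \<alpha> i j * Y k j)"
    by (rule sum.cong[OF refl], rule sum.swap)
  also have "\<dots> = (\<Sum>k\<in>I. \<Sum>i\<in>I. \<Sum>j\<in>I. \<gamma> k i * \<alpha> i j * Y k j)"
    by (rule sum.swap)
  also have "\<dots> = (\<Sum>k\<in>I. \<Sum>j\<in>I. \<Sum>i\<in>I. \<gamma> k i * \<alpha> i j * Y k j)"
    by (rule sum.cong[OF refl], rule sum.swap)
  finally have 1: "(\<Sum>i\<in>I. \<Sum>j\<in>I. \<Sum>k\<in>I. \<Sum>l\<in>I. \<alpha> i j * \<gamma> k l * of_bool (i = l) * Y k j) = \<dots>" .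
  have "(\<Sum>i\<in>I. \<Sum>j\<in>I. \<Sum>k\<in>I. \<Sum>l\<in>I. \<alpha> i j * \<gamma> k l * of_bool (k = j) * Y i l) =
      (\<Sum>i\<in>I. \<Sum>j\<in>I. \<Sum>l\<in>I. \<Sum>k\<in>I. \<alpha> i j * \<gamma> k l * of_bool (k = j) * Y i l)"
    by (rule sum.cong[OF refl], rule sum.cong[OF refl], rule sum.swap)
  also have "\<dots> = (\<Sum>i\<in>I. \<Sum>j\<in>I. \<Sum>l\<in>I. \<Sum>k\<in>I. if k = j then \<alpha> i j * \<gamma> k l * Y i l else 0)"
    by (intro sum.cong) auto
  also have "\<dots> = (\<Sum>i\<in>I. \<Sum>j\<in>I. \<Sum>l\<in>I. \<alpha> i j * \<gamma> j l * Y i l)"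
    by (intro sum.cong refl) (simp add: I)
  also have "\<dots> = (\<Sum>i\<in>I. \<Sum>l\<in>I. \<Sum>j\<in>I. \<alpha> i j * \<gamma> j l * Y i l)"
    by (rule sum.cong[OF refl], rule sum.swap)
  finally have 2: "(\<Sum>i\<in>I. \<Sum>j\<in>I. \<Sum>k\<in>I. \<Sum>l\<in>I. \<alpha> i j * \<gamma> k l * of_bool (k = j) * Y i l) = \<dots>" .
  show ?thesis
    by (simp only: right_diff_distrib left_diff_distrib sum_subtractf sum_distrib_right
        mult.assoc[symmetric] 1 2)
qed

context weight_module
begin

section \<open>The action in the coordinates \<open>x j\<close>\<close>

definition sgn_idx :: "nat \<Rightarrow> complex" where
  "sgn_idx i = (if i = Suc n then - 1 else 1)"

text \<open>The entries of \<open>A\<close> conjugated by the diagonal matrix with entries 1, ...,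
  1, -1. The conjugation absorbs the case distinction of signs in \<open>M_unit_eq\<close> and,
  being an automorphism, respects brackets.\<close>

definition entry :: "complex mat \<Rightarrow> nat \<Rightarrow> nat \<Rightarrow> complex" where
  "entry A i j = sgn_idx i * sgn_idx j * A $$ (i - 1, j - 1)"

definition unit_act :: "(nat \<Rightarrow> nat \<Rightarrow> complex) \<Rightarrow> cpoly \<Rightarrow> cpoly" where
  "unit_act a f = (\<Sum>i=1..Suc n. \<Sum>j=1..Suc n. pconst (a i j) * (x j * shift i j f))"

text \<open>Substitute h_k = b - x_k. As the trace is 0, the constants add up to -(n + 1) b times
  the last entry, and \<open>sum_x\<close> together with (n + 1) b = N turns this into a combination
  of the \<open>x i\<close>.\<close>

lemma diagonal_act:
  assumes tr: "(\<Sum>i=1..Suc n. a i) = 0"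
  shows "(\<Sum>k=1..n. pconst (a k - a (Suc n)) * hvar k) = - (\<Sum>i=1..Suc n. pconst (a i) * x i)"
proof -
  let ?c = "a (Suc n)"
  have "(\<Sum>k=1..n. pconst (a k - ?c) * hvar k) =
      (\<Sum>k=1..n. pconst (a k * b) - pconst (?c * b) - pconst (a k) * x k + pconst ?c * x k)"
    by (rule sum.cong) (auto simp: x_def hom_distribs algebra_simps)
  also have "\<dots> = pconst ((\<Sum>k=1..n. a k) * b - of_nat n * ?c * b)
      - (\<Sum>k=1..n. pconst (a k) * x k) + pconst ?c * (\<Sum>k=1..n. x k)"
    by (simp add: sum.distrib sum_subtractf hom_distribs sum_distrib_left sum_distrib_right
        pconst_of_nat algebra_simps)
  also have "(\<Sum>k=1..n. a k) = - ?c" using tr by (simp add: eq_neg_iff_add_eq_0)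
  also have "(\<Sum>k=1..n. x k) = pconst (of_nat (n + 1) * b) - x (Suc n)"
    using sum_x by (simp only: N_eq pconst_of_nat) (simp add: algebra_simps)
  finally show ?thesis
    by (simp add: hom_distribs pconst_of_nat algebra_simps)
qed

lemma M_act_eq:
  assumes A: "A \<in> sl_mat n" and f: "f \<in> polys n"
  shows "M_act n b A f = - unit_act (entry A) f"
proof -
  have tr: "(\<Sum>i=1..Suc n. A $$ (i - 1, i - 1)) = 0"
    using A unfolding sl_mat_def by (simp add: sum.atLeast1_atMost_eq del: sum.cl_ivl_Suc)
  \<comment> \<open>The inner sum is completed by the missing term \<open>j = i\<close>, for which
    the shift is the identity. These corrections cancel against the diagonal part by
    \<open>diagonal_act\<close>.\<close>
  have off: "(\<Sum>j\<in>{1..Suc n} - {i}. pconst (A $$ (i - 1, j - 1)) * M_unit n b i j f) =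
      - (\<Sum>j=1..Suc n. pconst (entry A i j) * (x j * shift i j f)) + pconst (A $$ (i - 1, i - 1)) *
          x i * f"
    if i: "i \<in> {1..Suc n}" for i
  proof -
    have "(\<Sum>j\<in>{1..Suc n} - {i}. pconst (A $$ (i - 1, j - 1)) * M_unit n b i j f) =
       (\<Sum>j\<in>{1..Suc n} - {i}. - (pconst (entry A i j) * (x j * shift i j f)))"
      by (rule sum.cong) (use i f in \<open>auto simp: M_unit_eq entry_def sgn_idx_def hom_distribs\<close>)
    also have "\<dots> = - (\<Sum>j=1..Suc n. pconst (entry A i j) * (x j * shift i j f)) +
        pconst (entry A i i) * (x i * shift i i f)"
      using i by (subst sum_diff1) (auto simp: sum_negf simp del: sum.cl_ivl_Suc)
    finally show ?thesis by (simp add: entry_def sgn_idx_def mult.assoc)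
  qed
  have "(\<Sum>k=1..n. pconst (A $$ (k - 1, k - 1) - A $$ (n, n)) * (hvar k * f)) =
      - (\<Sum>i=1..Suc n. pconst (A $$ (i - 1, i - 1)) * x i * f)"
    using arg_cong[OF diagonal_act[OF tr], of "\<lambda>p. p * f"]
    by (simp add: sum_distrib_right mult.assoc del: sum.cl_ivl_Suc)
  moreover have "(\<Sum>i=1..Suc n. \<Sum>j\<in>{1..Suc n} - {i}. pconst (A $$ (i - 1, j - 1)) * M_unit n b i j
      f) =
     - unit_act (entry A) f + (\<Sum>i=1..Suc n. pconst (A $$ (i - 1, i - 1)) * x i * f)"
  proof -
    have "(\<Sum>i=1..Suc n. \<Sum>j\<in>{1..Suc n} - {i}. pconst (A $$ (i - 1, j - 1)) * M_unit n b i j f) =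
        (\<Sum>i=1..Suc n. - (\<Sum>j=1..Suc n. pconst (entry A i j) * (x j * shift i j f)) +
          pconst (A $$ (i - 1, i - 1)) * x i * f)"
      by (rule sum.cong[OF refl off])
    then show ?thesis by (simp add: unit_act_def sum_subtractf del: sum.cl_ivl_Suc)
  qed
  ultimately show ?thesis unfolding M_act_def by simp
qed

lemma unit_act_in_polys [simp, intro]: "f \<in> polys n \<Longrightarrow> unit_act a f \<in> polys n"
  unfolding unit_act_def by (intro sum_in_polys mult_in_polys) auto

lemma unit_act_add: "unit_act a (f + g) = unit_act a f + unit_act a g"
  by (simp add: unit_act_def hom_distribs distrib_left sum.distrib del: sum.cl_ivl_Suc)

lemma unit_act_scale: "unit_act a (pconst c * f) = pconst c * unit_act a f"
  by (simp add: unit_act_def hom_distribs sum_distrib_left mult.left_commute[of _ "pconst c"] del: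
      sum.cl_ivl_Suc)

lemma unit_act_add_left: "unit_act (\<lambda>i j. a i j + a' i j) f = unit_act a f + unit_act a' f"
  by (simp add: unit_act_def hom_distribs distrib_right sum.distrib del: sum.cl_ivl_Suc)

lemma unit_act_scale_left: "unit_act (\<lambda>i j. c * a i j) f = pconst c * unit_act a f"
  by (simp add: unit_act_def hom_distribs sum_distrib_left mult.assoc del: sum.cl_ivl_Suc)

lemma unit_act_cong:
  assumes "\<And>i j. i \<in> {1..Suc n} \<Longrightarrow> j \<in> {1..Suc n} \<Longrightarrow> a i j = a' i j"
  shows "unit_act a f = unit_act a' f"
  unfolding unit_act_def using assms by (intro sum.cong) auto

lemma unit_commutator:
  assumes "i \<in> {1..Suc n}" "j \<in> {1..Suc n}" "k \<in> {1..Suc n}" "l \<in> {1..Suc n}"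
  shows "x j * shift i j (x l * shift k l f) - x l * shift k l (x j * shift i j f) =
    of_bool (i = l) * (x j * shift k j f) - of_bool (k = j) * (x l * shift i l f)"
proof -
  let ?g = "shift i j (shift k l f)"
  have "x j * shift i j (x l * shift k l f) - x l * shift k l (x j * shift i j f) =
      (of_bool (i = l) * x j - of_bool (k = j) * x l + of_bool (j = l) * (x l - x j)) * ?g"
    using assms by (simp add: hom_distribs shift_x shift_commute[of k l] algebra_simps eq_commute)
  \<comment> \<open>Moving one coefficient past the other shift produces a third contribution when
    \<open>j = l\<close>, which is zero because then \<open>x l = x j\<close>.\<close>
  also have "of_bool (j = l) * (x l - x j) = 0" by simp
  also have "(of_bool (i = l) * x j - of_bool (k = j) * x l + 0) * ?g =
      of_bool (i = l) * (x j * shift k j f) - of_bool (k = j) * (x l * shift i l f)"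
    by (auto simp: of_bool_def left_diff_distrib mult.assoc) (simp_all add: shift_commute[of _ j j
        l])
  finally show ?thesis .
qed

text \<open>The two matrix products appear in reversed order: \<open>unit_act\<close> is an
  antihomomorphism, and it is the minus sign in \<open>M_act_eq\<close> that makes the action a
  representation.\<close>

lemma unit_act_commutator:
  "unit_act a (unit_act c f) - unit_act c (unit_act a f) =
   unit_act (\<lambda>i j. (\<Sum>k=1..Suc n. c i k * a k j) - (\<Sum>k=1..Suc n. a i k * c k j)) f"
proof -
  let ?I = "{1..Suc n}"
  let ?X = "\<lambda>i j f. x j * shift i j f"
  have comp: "unit_act a (unit_act c f) =
      (\<Sum>i\<in>?I. \<Sum>j\<in>?I. \<Sum>k\<in>?I. \<Sum>l\<in>?I. pconst (a i j) * pconst (c k l) * ?X i j (?X k l f))" for a c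
    unfolding unit_act_def
    by (simp add: shift.hom_sum shift.hom_mult sum_distrib_left mult_ac del: sum.cl_ivl_Suc)
  have "unit_act a (unit_act c f) - unit_act c (unit_act a f) =
     (\<Sum>i\<in>?I. \<Sum>j\<in>?I. \<Sum>k\<in>?I. \<Sum>l\<in>?I. pconst (a i j) * pconst (c k l) * (?X i j (?X k l f) - ?X k l
         (?X i j f)))"
    unfolding comp[of a c] comp[of c a]
    unfolding sum_swap4[of "\<lambda>i j k l. pconst (c i j) * pconst (a k l) * ?X i j (?X k l f)"]
    by (simp add: sum_subtractf right_diff_distrib mult.commute[of "pconst (c _ _)"] del:
        sum.cl_ivl_Suc)
  also have "\<dots> = (\<Sum>i\<in>?I. \<Sum>j\<in>?I. \<Sum>k\<in>?I. \<Sum>l\<in>?I. pconst (a i j) * pconst (c k l) *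
      (of_bool (i = l) * ?X k j f - of_bool (k = j) * ?X i l f))"
    by (intro sum.cong refl arg_cong[where f = "(*) _"] unit_commutator)
  also have "\<dots> = (\<Sum>i\<in>?I. \<Sum>j\<in>?I. ((\<Sum>k\<in>?I. pconst (c i k) * pconst (a k j)) -
      (\<Sum>k\<in>?I. pconst (a i k) * pconst (c k j))) * ?X i j f)"
    by (rule sum_commutator) simp
  also have "\<dots> = unit_act (\<lambda>i j. (\<Sum>k=1..Suc n. c i k * a k j) - (\<Sum>k=1..Suc n. a i k * c k j)) f"
    unfolding unit_act_def by (simp add: hom_distribs del: sum.cl_ivl_Suc)
  finally show ?thesis .
qed

end

section \<open>Submodules and quotients of representations\<close>

lemma sl_mat_carrier: "A \<in> sl_mat n \<Longrightarrow> A \<in> carrier_mat (Suc n) (Suc n)"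
  by (simp add: sl_mat_def)

lemma add_in_sl_mat: "A \<in> sl_mat n \<Longrightarrow> B \<in> sl_mat n \<Longrightarrow> A + B \<in> sl_mat n"
  by (auto simp: sl_mat_def sum.distrib simp del: sum.lessThan_Suc)

lemma smult_in_sl_mat: "A \<in> sl_mat n \<Longrightarrow> c \<cdot>\<^sub>m A \<in> sl_mat n"
  by (auto simp: sl_mat_def simp del: sum.lessThan_Suc simp flip: sum_distrib_left)

lemma lie_bracket_index:
  assumes "A \<in> carrier_mat (Suc n) (Suc n)" "B \<in> carrier_mat (Suc n) (Suc n)" "r < Suc n" "c < Suc
      n"
  shows "lie_bracket A B $$ (r, c) =
    (\<Sum>k<Suc n. A $$ (r, k) * B $$ (k, c)) - (\<Sum>k<Suc n. B $$ (r, k) * A $$ (k, c))"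
  using assms
  by (simp add: lie_bracket_def scalar_prod_def lessThan_atLeast0 del: sum.op_ivl_Suc)

lemma lie_bracket_in_sl_mat:
  assumes "A \<in> sl_mat n" "B \<in> sl_mat n"
  shows "lie_bracket A B \<in> sl_mat n"
proof -
  note car = assms[THEN sl_mat_carrier]
  have "(\<Sum>r<Suc n. lie_bracket A B $$ (r, r)) =
    (\<Sum>r<Suc n. (\<Sum>k<Suc n. A $$ (r, k) * B $$ (k, r)) - (\<Sum>k<Suc n. B $$ (r, k) * A $$ (k, r)))"
    by (rule sum.cong[OF refl]) (use lie_bracket_index[OF car] in blast)
  also have "\<dots> = 0"
    unfolding sum_subtractf
    by (subst sum.swap) (simp add: mult.commute del: sum.lessThan_Suc)
  finally show ?thesis using car by (auto simp: sl_mat_def lie_bracket_def)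
qed

lemma (in abelian_group) eq_minus_iff:
  assumes "x \<in> carrier G" "y \<in> carrier G" "z \<in> carrier G"
  shows "z = x \<ominus> y \<longleftrightarrow> z \<oplus> y = x"
proof
  show "z \<oplus> y = x" if "z = x \<ominus> y" using assms that by (simp add: a_minus_def a_assoc l_neg)
  show "z = x \<ominus> y" if "z \<oplus> y = x" unfolding that[symmetric] using assms by (simp add: a_minus_def
      a_assoc r_neg)
qed

text \<open>The bracket axiom is put in a form without subtraction, so that on submodules and images
  it needs only compatibility with addition and the action.\<close>

lemma sl_moduleI:
  fixes V :: "'v lie_rep" (structure)
  assumes vs: "vectorspace (class_ring :: complex ring) V"
    and "\<And>A v. \<lbrakk>A \<in> sl_mat n; v \<in> carrier V\<rbrakk> \<Longrightarrow> act V A v \<in> carrier V"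
    and "\<And>A v w. \<lbrakk>A \<in> sl_mat n; v \<in> carrier V; w \<in> carrier V\<rbrakk> \<Longrightarrow>
          act V A (v \<oplus> w) = act V A v \<oplus> act V A w"
    and "\<And>A c v. \<lbrakk>A \<in> sl_mat n; v \<in> carrier V\<rbrakk> \<Longrightarrow> act V A (c \<odot> v) = c \<odot> act V A v"
    and "\<And>A B v. \<lbrakk>A \<in> sl_mat n; B \<in> sl_mat n; v \<in> carrier V\<rbrakk> \<Longrightarrow>
          act V (A + B) v = act V A v \<oplus> act V B v"
    and "\<And>A c v. \<lbrakk>A \<in> sl_mat n; v \<in> carrier V\<rbrakk> \<Longrightarrow> act V (c \<cdot>\<^sub>m A) v = c \<odot> act V A v"
    and br: "\<And>A B v. \<lbrakk>A \<in> sl_mat n; B \<in> sl_mat n; v \<in> carrier V\<rbrakk> \<Longrightarrow>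
          act V (lie_bracket A B) v \<oplus> act V B (act V A v) = act V A (act V B v)"
  shows "sl_module n V"
proof -
  interpret vectorspace "class_ring :: complex ring" V by fact
  show ?thesis
    by unfold_locales (use assms lie_bracket_in_sl_mat in \<open>simp_all add: M.eq_minus_iff\<close>)
qed

lemma (in sl_module) act_bracket_add:
  assumes "A \<in> sl_mat n" "B \<in> sl_mat n" "v \<in> carrier V"
  shows "act V (lie_bracket A B) v \<oplus> act V B (act V A v) = act V A (act V B v)"
  using act_bracket[OF assms] assms
  by (subst (asm) M.eq_minus_iff) (simp_all add: act_closed lie_bracket_in_sl_mat)

lemma sl_submoduleD:
  fixes V :: "'v lie_rep" (structure)
  assumes "sl_submodule n V W"
  shows "W \<subseteq> carrier V" "\<zero> \<in> W" "\<And>v w. v \<in> W \<Longrightarrow> w \<in> W \<Longrightarrow> v \<oplus> w \<in> W"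
    "\<And>c v. v \<in> W \<Longrightarrow> c \<odot> v \<in> W" "\<And>A v. A \<in> sl_mat n \<Longrightarrow> v \<in> W \<Longrightarrow> act V A v \<in> W"
  using assms by (auto simp: sl_submodule_def subspace_def submodule_def)

lemma sl_submoduleI:
  fixes V :: "'v lie_rep" (structure)
  assumes "sl_module n V" "W \<subseteq> carrier V" "\<zero> \<in> W" "\<And>v w. v \<in> W \<Longrightarrow> w \<in> W \<Longrightarrow> v \<oplus> w \<in> W"
    "\<And>c v. v \<in> W \<Longrightarrow> c \<odot> v \<in> W" "\<And>A v. A \<in> sl_mat n \<Longrightarrow> v \<in> W \<Longrightarrow> act V A v \<in> W"
  shows "sl_submodule n V W"
proof -
  interpret sl_module n V by fact
  show ?thesis
    using assms vectorspace_axioms module_axioms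
    by (auto simp: sl_submodule_def subspace_def submodule_def)
qed

lemma sub_rep_simps [simp]:
  "carrier (sub_rep V W) = W" "zero (sub_rep V W) = zero V" "add (sub_rep V W) = add V"
  "smult (sub_rep V W) = smult V" "act (sub_rep V W) = act V"
  by (simp_all add: sub_rep_def)

lemma sl_module_sub_rep:
  assumes V: "sl_module n V" and W: "sl_submodule n V W"
  shows "sl_module n (sub_rep V W)"
proof -
  interpret sl_module n V by fact
  note D = sl_submoduleD[OF W]
  have "vectorspace class_ring (sub_rep V W)"
    using W unfolding sub_rep_def sl_submodule_def by (intro subspace_is_vs) simp
  then show ?thesis
    by (rule sl_moduleI)
      (use D in \<open>simp_all add: subset_iff act_add_right act_smult_right act_add_left
          act_smult_left act_bracket_add\<close>)
qed

lemma simple_sub_rep: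
  assumes V: "sl_module n V" and W: "sl_submodule n V W" "W \<noteq> {\<zero>\<^bsub>V\<^esub>}"
    and min: "\<And>U. sl_submodule n V U \<Longrightarrow> U \<noteq> {\<zero>\<^bsub>V\<^esub>} \<Longrightarrow> U \<subseteq> W \<Longrightarrow> U = W"
  shows "simple_sl_module n (sub_rep V W)"
  unfolding simple_sl_module_def
proof (intro conjI allI impI)
  show "sl_module n (sub_rep V W)" by (rule sl_module_sub_rep[OF V W(1)])
  show "carrier (sub_rep V W) \<noteq> {\<zero>\<^bsub>sub_rep V W\<^esub>}" using W by simp
  fix U assume "sl_submodule n (sub_rep V W) U"
  note U = sl_submoduleD[OF this, simplified]
  have "sl_submodule n V U"
    by (rule sl_submoduleI[OF V]) (use U sl_submoduleD(1)[OF W(1)] in auto)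
  then show "U = {\<zero>\<^bsub>sub_rep V W\<^esub>} \<or> U = carrier (sub_rep V W)"
    using min U(1) by auto
qed

text \<open>All axioms are equations and pass along a surjection compatible with the operations.
  Applied to the coset map, this makes the quotient a module.\<close>

lemma sl_module_image:
  fixes V :: "'v lie_rep" and Q :: "'w lie_rep"
  assumes V: "sl_module n V"
    and car: "carrier Q = \<pi> ` carrier V" and zero: "\<zero>\<^bsub>Q\<^esub> = \<pi> \<zero>\<^bsub>V\<^esub>"
    and add: "\<And>v w. v \<in> carrier V \<Longrightarrow> w \<in> carrier V \<Longrightarrow> \<pi> v \<oplus>\<^bsub>Q\<^esub> \<pi> w = \<pi> (v \<oplus>\<^bsub>V\<^esub> w)"
    and smult: "\<And>c v. v \<in> carrier V \<Longrightarrow> c \<odot>\<^bsub>Q\<^esub> \<pi> v = \<pi> (c \<odot>\<^bsub>V\<^esub> v)"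
    and act: "\<And>A v. A \<in> sl_mat n \<Longrightarrow> v \<in> carrier V \<Longrightarrow> act Q A (\<pi> v) = \<pi> (act V A v)"
  shows "sl_module n Q"
proof -
  interpret sl_module n V by fact
  have smult_c: "c \<odot>\<^bsub>V\<^esub> v \<in> carrier V" if "v \<in> carrier V" for c v
    using that by (simp add: smult_closed)
  have vs: "vectorspace class_ring Q"
  proof (rule vectorspaceI_complex)
    show "abelian_group Q"
    proof (rule abelian_groupI)
      fix X assume "X \<in> carrier Q"
      then obtain v where v: "v \<in> carrier V" "X = \<pi> v" by (auto simp: car)
      then have "\<pi> (\<ominus>\<^bsub>V\<^esub> v) \<oplus>\<^bsub>Q\<^esub> X = \<zero>\<^bsub>Q\<^esub>" by (simp add: add zero M.l_neg)
      then show "\<exists>Y\<in>carrier Q. Y \<oplus>\<^bsub>Q\<^esub> X = \<zero>\<^bsub>Q\<^esub>" using v by (auto simp: car)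
    qed (auto simp: car zero add M.a_ac)
  qed (auto simp: car add smult smult_c smult_l_distr smult_r_distr smult_assoc1
        smult_l_distr[simplified] smult_r_distr[simplified] smult_assoc1[simplified]
            smult_one[simplified])
  show ?thesis
    by (rule sl_moduleI[OF vs])
      (auto simp: car add smult act smult_c act_closed act_add_right act_smult_right act_add_left
        act_smult_left act_bracket_add add_in_sl_mat smult_in_sl_mat lie_bracket_in_sl_mat)
qed

section \<open>Quotient representations\<close>

locale sl_quotient = sl_module n V for n and V :: "'v lie_rep" (structure) +
  fixes W
  assumes W: "sl_submodule n V W"
begin

sublocale W: abelian_subgroup W V
proof (rule abelian_subgroupI3)
  show "additive_subgroup W V"
  proof (rule additive_subgroup.intro, rule group.subgroupI)
    show "Group.group (add_monoid V)" by (rule M.a_group)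
    note D = sl_submoduleD[OF W]
    show "W \<subseteq> carrier (add_monoid V)" "W \<noteq> {}" using D by auto
    fix v w assume "v \<in> W"
    then show "w \<in> W \<Longrightarrow> v \<otimes>\<^bsub>add_monoid V\<^esub> w \<in> W" using D by simp
    have "\<ominus> v = (- 1) \<odot> v"
      using \<open>v \<in> W\<close> D(1) smult_minus_1 by (simp add: subset_iff class_ring_simps)
    then show "inv\<^bsub>add_monoid V\<^esub> v \<in> W"
      using D(4)[OF \<open>v \<in> W\<close>, of "- 1"] by (simp add: a_inv_def)
  qed
qed (rule M.abelian_group_axioms)

abbreviation coset :: "'v \<Rightarrow> 'v set" where "coset v \<equiv> W +> v"

lemma coset_eqI: "v \<in> coset w \<Longrightarrow> w \<in> carrier V \<Longrightarrow> coset v = coset w"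
  using M.a_repr_independence[OF _ _ W.a_subgroup] by metis

lemma coset_eq_W_iff:
  assumes "v \<in> carrier V"
  shows "coset v = W \<longleftrightarrow> v \<in> W"
  using W.a_rcos_self[OF assms] W.a_rcos_const by auto

text \<open>The quotient operations are unions over representatives. Since \<open>T\<close> is
  additive and preserves \<open>W\<close>, all members of the union coincide.\<close>

lemma Union_coset_image:
  assumes T: "\<And>v. v \<in> carrier V \<Longrightarrow> T v \<in> carrier V"
    and add: "\<And>v w. v \<in> carrier V \<Longrightarrow> w \<in> carrier V \<Longrightarrow> T (v \<oplus> w) = T v \<oplus> T w"
    and W: "\<And>w. w \<in> W \<Longrightarrow> T w \<in> W" and v: "v \<in> carrier V"
  shows "(\<Union>y\<in>coset v. coset (T y)) = coset (T v)"
proof -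
  have "coset (T y) = coset (T v)" if y: "y \<in> coset v" for y
  proof -
    obtain w where w: "w \<in> W" "y = w \<oplus> v" using y by (auto simp: a_r_coset_def')
    then have "T y = T w \<oplus> T v" using add v by simp
    then have "T y \<in> coset (T v)" using W[OF w(1)] by (auto simp: a_r_coset_def')
    then show ?thesis using T v by (intro coset_eqI) auto
  qed
  then show ?thesis using W.a_rcos_self[OF v] by blast
qed

lemma quot_rep_carrier: "carrier (quot_rep V W) = coset ` carrier V"
  by (auto simp: quot_rep_def A_RCOSETS_def')

lemma quot_rep_zero: "\<zero>\<^bsub>quot_rep V W\<^esub> = W"
  by (simp add: quot_rep_def)

lemma quot_rep_add:
  "v \<in> carrier V \<Longrightarrow> w \<in> carrier V \<Longrightarrow> coset v \<oplus>\<^bsub>quot_rep V W\<^esub> coset w = coset (v \<oplus> w)"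
  by (simp add: quot_rep_def W.a_rcos_sum)

lemma quot_rep_smult:
  assumes "v \<in> carrier V"
  shows "c \<odot>\<^bsub>quot_rep V W\<^esub> coset v = coset (c \<odot> v)"
proof -
  have "(\<Union>y\<in>coset v. coset (c \<odot> y)) = coset (c \<odot> v)"
    by (rule Union_coset_image)
      (use assms sl_submoduleD[OF W] in \<open>auto simp: smult_closed smult_r_distr\<close>)
  then show ?thesis by (simp add: quot_rep_def)
qed

lemma quot_rep_act:
  assumes "A \<in> sl_mat n" "v \<in> carrier V"
  shows "act (quot_rep V W) A (coset v) = coset (act V A v)"
proof -
  have "(\<Union>y\<in>coset v. coset (act V A y)) = coset (act V A v)"
    by (rule Union_coset_image)
      (use assms sl_submoduleD[OF W] in \<open>auto simp: act_closed act_add_right\<close>)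
  then show ?thesis by (simp add: quot_rep_def)
qed

lemma sl_module_quot_rep: "sl_module n (quot_rep V W)"
  by (rule sl_module_image[where \<pi> = coset, OF sl_module_axioms])
    (simp_all add: quot_rep_carrier quot_rep_add quot_rep_smult quot_rep_act quot_rep_zero
        W.a_rcos_const)

text \<open>The half of the correspondence theorem that reduces simplicity of the quotient to
  maximality of \<open>W\<close>.\<close>

lemma sl_submodule_preimage:
  assumes U: "sl_submodule n (quot_rep V W) U"
  shows "sl_submodule n V {v \<in> carrier V. coset v \<in> U}" (is "sl_submodule n V ?P")
    and "W \<subseteq> {v \<in> carrier V. coset v \<in> U}" and "U = coset ` {v \<in> carrier V. coset v \<in> U}"
proof -
  note D = sl_submoduleD[OF U]
  show "W \<subseteq> ?P" using D(2) by (auto simp: W.a_rcos_const quot_rep_zero)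
  show "U = coset ` ?P" using D(1) by (auto simp: quot_rep_carrier)
  show "sl_submodule n V ?P"
  proof (rule sl_submoduleI[OF sl_module_axioms])
    show "\<zero> \<in> ?P" using \<open>W \<subseteq> ?P\<close> W.zero_closed by blast
    show "v \<oplus> w \<in> ?P" if "v \<in> ?P" "w \<in> ?P" for v w
      using that D(3)[of "coset v" "coset w"] by (auto simp: quot_rep_add)
    show "c \<odot> v \<in> ?P" if "v \<in> ?P" for c v
      using that D(4)[of "coset v" c] by (auto simp: quot_rep_smult smult_closed)
    show "act V A v \<in> ?P" if "A \<in> sl_mat n" "v \<in> ?P" for A v
      using that D(5)[of A "coset v"] by (auto simp: quot_rep_act act_closed)
  qed auto
qed

lemma simple_quot_rep:
  assumes "W \<noteq> carrier V"
    and max: "\<And>U. sl_submodule n V U \<Longrightarrow> W \<subseteq> U \<Longrightarrow> U = W \<or> U = carrier V"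
  shows "simple_sl_module n (quot_rep V W)"
  unfolding simple_sl_module_def
proof (intro conjI allI impI)
  show "sl_module n (quot_rep V W)" by (rule sl_module_quot_rep)
  obtain v where "v \<in> carrier V" "v \<notin> W" using assms(1) W.a_subset by blast
  then show "carrier (quot_rep V W) \<noteq> {\<zero>\<^bsub>quot_rep V W\<^esub>}"
    using coset_eq_W_iff[of v] by (auto simp: quot_rep_carrier quot_rep_zero)
  fix U assume U: "sl_submodule n (quot_rep V W) U"
  note P = sl_submodule_preimage[OF U]
  from max[OF P(1,2)] show "U = {\<zero>\<^bsub>quot_rep V W\<^esub>} \<or> U = carrier (quot_rep V W)"
  proof
    assume *: "{v \<in> carrier V. coset v \<in> U} = W"
    have "coset ` W = {W}" using W.a_rcos_const W.zero_closed by blast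
    then show ?thesis using P(3) unfolding * by (simp add: quot_rep_zero)
  next
    assume *: "{v \<in> carrier V. coset v \<in> U} = carrier V"
    then show ?thesis using P(3) unfolding * by (simp add: quot_rep_carrier)
  qed
qed

end

section \<open>Submodules as stable ideals\<close>

lemma e_mat_in_sl_mat:
  assumes "i \<noteq> j" shows "e_mat n i j \<in> sl_mat n"
  using assms by (auto simp: sl_mat_def e_mat_def intro!: sum.neutral)

lemma h_mat_in_sl_mat:
  assumes "k \<in> {1..n}" shows "h_mat n k \<in> sl_mat n"
proof -
  have "(\<Sum>r<Suc n. h_mat n k $$ (r, r)) = (\<Sum>r<Suc n. (if r = k - 1 then 1 else 0) - 1 / of_nat
      (Suc n))"
    by (rule sum.cong) (use assms in \<open>auto simp: h_mat_def e_mat_def\<close>)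
  also have "\<dots> = 0"
    using assms unfolding sum_subtractf by (subst sum.delta) (auto simp del: of_nat_Suc)
  finally have "(\<Sum>r<Suc n. h_mat n k $$ (r, r)) = 0" .
  moreover have "h_mat n k \<in> carrier_mat (Suc n) (Suc n)"
    unfolding h_mat_def by (rule minus_carrier_mat) simp
  ultimately show ?thesis by (simp add: sl_mat_def)
qed

lemma M_rep_simps [simp]:
  "carrier (M_rep n b) = polys n" "zero (M_rep n b) = 0" "add (M_rep n b) = (+)"
  "smult (M_rep n b) = (\<lambda>c f. pconst c * f)" "act (M_rep n b) = M_act n b"
  by (simp_all add: M_rep_def)

context weight_module
begin

lemma entry_add:
  assumes "A \<in> sl_mat n" "B \<in> sl_mat n" "i \<in> {1..Suc n}" "j \<in> {1..Suc n}"
  shows "entry (A + B) i j = entry A i j + entry B i j"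
  using assms by (auto simp: entry_def sl_mat_def algebra_simps)

lemma entry_smult:
  assumes "A \<in> sl_mat n" "i \<in> {1..Suc n}" "j \<in> {1..Suc n}"
  shows "entry (c \<cdot>\<^sub>m A) i j = c * entry A i j"
  using assms by (auto simp: entry_def sl_mat_def algebra_simps)

lemma entry_lie_bracket:
  assumes "A \<in> sl_mat n" "B \<in> sl_mat n" "i \<in> {1..Suc n}" "j \<in> {1..Suc n}"
  shows "entry (lie_bracket A B) i j =
    (\<Sum>k=1..Suc n. entry A i k * entry B k j) - (\<Sum>k=1..Suc n. entry B i k * entry A k j)"
proof -
  have [simp]: "sgn_idx k * sgn_idx k = 1" for k by (simp add: sgn_idx_def)
  have prods: "entry C i k * entry D k j = sgn_idx i * sgn_idx j * (C $$ (i - 1, k - 1) * D $$ (k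
      - 1, j - 1))"
    for C D k
  proof -
    have "entry C i k * entry D k j = (sgn_idx k * sgn_idx k) *
        (sgn_idx i * sgn_idx j * (C $$ (i - 1, k - 1) * D $$ (k - 1, j - 1)))"
      unfolding entry_def by (simp only: mult_ac)
    then show ?thesis by simp
  qed
  have "entry (lie_bracket A B) i j = sgn_idx i * sgn_idx j *
    ((\<Sum>k<Suc n. A $$ (i - 1, k) * B $$ (k, j - 1)) - (\<Sum>k<Suc n. B $$ (i - 1, k) * A $$ (k, j - 1)))"
  proof -
    have idx: "i - 1 < Suc n" "j - 1 < Suc n" using assms by auto
    show ?thesis
      unfolding entry_def lie_bracket_index[OF sl_mat_carrier[OF assms(1)] sl_mat_carrier[OF
          assms(2)] idx] ..
  qed
  then show ?thesis
    unfolding prods sum_distrib_left[symmetric] right_diff_distrib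
    by (simp add: sum.atLeast1_atMost_eq del: sum.lessThan_Suc sum.cl_ivl_Suc)
qed

lemma unit_act_uminus: "unit_act a (- f) = - unit_act a f"
  using unit_act_scale[of a "- 1" f] by (simp add: pconst.hom_uminus)

lemma sl_module_M_rep: "sl_module n (M_rep n b)"
proof (rule sl_moduleI)
  have "abelian_group (M_rep n b)"
    by (rule abelian_groupI) (auto simp: algebra_simps intro: bexI[of _ "- _"])
  then show "vectorspace class_ring (M_rep n b)"
    by (rule vectorspaceI_complex) (simp_all add: hom_distribs algebra_simps)
next
  fix A B v assume AB: "A \<in> sl_mat n" "B \<in> sl_mat n" and v: "v \<in> carrier (M_rep n b)"
  have "unit_act (entry (lie_bracket A B)) v = unit_act (\<lambda>i j.
    (\<Sum>k=1..Suc n. entry A i k * entry B k j) - (\<Sum>k=1..Suc n. entry B i k * entry A k j)) v"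
    by (rule unit_act_cong) (rule entry_lie_bracket[OF AB])
  \<comment> \<open>The reversed commutator; replacing each \<open>unit_act\<close> by its negative,
    as in \<open>M_act_eq\<close>, restores the order.\<close>
  also have "\<dots> = unit_act (entry B) (unit_act (entry A) v) - unit_act (entry A) (unit_act (entry
      B) v)"
    by (rule unit_act_commutator[symmetric])
  finally show "act (M_rep n b) (lie_bracket A B) v \<oplus>\<^bsub>M_rep n b\<^esub> act (M_rep n b) B (act (M_rep n
      b) A v) =
      act (M_rep n b) A (act (M_rep n b) B v)"
    using AB v by (simp add: M_act_eq lie_bracket_in_sl_mat unit_act_uminus)
  have "unit_act (entry (A + B)) v = unit_act (\<lambda>i j. entry A i j + entry B i j) v"
    by (rule unit_act_cong) (rule entry_add[OF AB])
  then show "act (M_rep n b) (A + B) v = act (M_rep n b) A v \<oplus>\<^bsub>M_rep n b\<^esub> act (M_rep n b) B v"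
    using AB v by (simp add: M_act_eq add_in_sl_mat unit_act_add_left)
  fix c
  have "unit_act (entry (c \<cdot>\<^sub>m A)) v = unit_act (\<lambda>i j. c * entry A i j) v"
    by (rule unit_act_cong) (rule entry_smult[OF AB(1)])
  then show "act (M_rep n b) (c \<cdot>\<^sub>m A) v = c \<odot>\<^bsub>M_rep n b\<^esub> act (M_rep n b) A v"
    using AB v by (simp add: M_act_eq smult_in_sl_mat unit_act_scale_left)
qed (simp_all add: M_act_eq unit_act_add unit_act_scale uminus_in_polys)

definition stable :: "cpoly set \<Rightarrow> bool" where
  "stable I \<longleftrightarrow> Uh_ideal n I \<and>
    (\<forall>i\<in>{1..Suc n}. \<forall>j\<in>{1..Suc n}. i \<noteq> j \<longrightarrow> (\<forall>f\<in>I. x j * shift i j f \<in> I))"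

text \<open>The elements h_k act as multiplications and the matrix units as signed
  \<open>x j * shift i j\<close>. Conversely the whole action is a combination of these, the terms
  with \<open>i = j\<close> being multiplications by \<open>x i\<close>.\<close>

lemma sl_submodule_iff_stable: "sl_submodule n (M_rep n b) I \<longleftrightarrow> stable I"
proof
  assume "sl_submodule n (M_rep n b) I"
  note D = sl_submoduleD[OF this, simplified]
  have "hvar k * f \<in> I" if "k \<in> {1..n}" "f \<in> I" for k f
    using D(5)[OF h_mat_in_sl_mat that(2)] that(1) by (simp add: M_act_h_mat)
  then have ideal: "Uh_ideal n I" using D by (auto simp: Uh_ideal_def)
  have "x j * shift i j f \<in> I" if "i \<in> {1..Suc n}" "j \<in> {1..Suc n}" "i \<noteq> j" "f \<in> I" for i j f
  proof -
    have "M_unit n b i j f \<in> I"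
      using D(5)[OF e_mat_in_sl_mat that(4)] that M_act_e_mat by metis
    moreover have "f \<in> polys n" using D(1) that by auto
    ultimately show ?thesis
      using M_unit_eq[of f i j] that(1-3) D(4)[of "M_unit n b i j f" "- 1"]
      by (auto simp: pconst.hom_uminus split: if_splits)
  qed
  then show "stable I" using ideal by (auto simp: stable_def)
next
  assume I: "stable I"
  then have ideal: "Uh_ideal n I" by (simp add: stable_def)
  show "sl_submodule n (M_rep n b) I"
  proof (rule sl_submoduleI[OF sl_module_M_rep])
    fix A f assume A: "A \<in> sl_mat n" and f: "f \<in> I"
    have fp: "f \<in> polys n" using f ideal by (auto simp: Uh_ideal_def)
    have "x j * shift i j f \<in> I" if "i \<in> {1..Suc n}" "j \<in> {1..Suc n}" for i j
      using that I f Uh_ideal_mult[OF ideal x_in_polys[OF that(2)] f]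
      by (cases "i = j") (auto simp: stable_def)
    then have "unit_act (entry A) f \<in> I" unfolding unit_act_def
      using ideal by (intro Uh_ideal_sum[OF ideal]) (auto simp: Uh_ideal_def)
    then have "pconst (- 1) * unit_act (entry A) f \<in> I" using ideal by (auto simp: Uh_ideal_def)
    then show "act (M_rep n b) A f \<in> I" by (simp add: M_act_eq[OF A fp] pconst.hom_uminus)
  qed (use ideal in \<open>auto simp: Uh_ideal_def\<close>)
qed

text \<open>The operator evaluates \<open>f\<close> at m + e_i - e_j, taken with all n + 1
  coordinates. This leaves the admissible points only if coordinate j of \<open>m\<close> is 0, and
  then the factor \<open>x j\<close> vanishes.\<close>

lemma W_stable: "stable W"
proof -
  have "Uh_ideal n W" by (auto simp: Uh_ideal_def W_def hom_distribs)
  moreover have "x j * shift i j f \<in> W"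
    if ij: "i \<in> {1..Suc n}" "j \<in> {1..Suc n}" "i \<noteq> j" and f: "f \<in> W" for i j f
  proof -
    have fp: "f \<in> polys n" and v: "\<And>m. m \<in> exponents n \<Longrightarrow> tdeg n m \<le> N \<Longrightarrow> ev b m f = 0"
      using f by (auto simp: W_def)
    have "ev b m (x j) * ev b m (shift i j f) = 0" if m: "m \<in> exponents n" "tdeg n m \<le> N" for m
    proof (cases "j = Suc n")
      case True
      then have i: "i \<in> {1..n}" using ij by auto
      show ?thesis
      proof (cases "tdeg n m = N")
        case False
        have "ev b m (shift i j f) = ev b (m + Poly_Mapping.single i 1) f"
          using fp m i True by (intro ev_shift) (auto simp: lookup_add lookup_single when_def)
        then show ?thesis using v[of "m + Poly_Mapping.single i 1"] m i False by simp
      qed (use True m ij in \<open>simp add: ev_x\<close>)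
    next
      case False
      show ?thesis
      proof (cases "Poly_Mapping.lookup m j = 0")
        case True
        then show ?thesis using False m ij by (simp add: ev_x)
      next
        case nz: False
        obtain m0 where m0: "m0 \<in> exponents n" "j \<in> {1..n}" "m = m0 + Poly_Mapping.single j 1"
          using exponents_remove_single[OF m(1), of j] nz by auto
        \<comment> \<open>For \<open>i = Suc n\<close> the unit goes to the last coordinate, which
          an exponent vector does not record.\<close>
        define m' where "m' = (if i = Suc n then m0 else m0 + Poly_Mapping.single i 1)"
        have m': "m' \<in> exponents n" "tdeg n m' \<le> N"
          using m0 m(2) ij by (auto simp: m'_def)
        have "ev b m (shift i j f) = ev b m' f"
          using fp m' by (intro ev_shift)
            (auto simp: m'_def m0(3) lookup_add lookup_single when_def)
        then show ?thesis using v[OF m'] by simp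
      qed
    qed
    then show ?thesis using fp ij by (auto simp: W_def hom_distribs)
  qed
  ultimately show ?thesis by (auto simp: stable_def)
qed

end

section \<open>Minimality and maximality of the vanishing ideal\<close>

lemma keys_eq_0:
  assumes "c \<noteq> 0" "\<And>m. m \<in> Poly_Mapping.keys c \<Longrightarrow> m = 0"
  shows "Poly_Mapping.keys c = {0}"
proof -
  obtain m where "m \<in> Poly_Mapping.keys c"
    using assms(1) by (auto simp: poly_mapping_eq_iff fun_eq_iff in_keys_iff)
  then show ?thesis using assms(2) by blast
qed

context weight_module
begin

lemma polys_expansion:
  assumes "f \<in> polys n"
  obtains c where "c \<in> polys n" "f = lin_ext P c"
  using assms polys_eq_lin_ext_P by blast

section \<open>Difference and raising operators on falling factorials\<close>

abbreviation q :: "nat \<Rightarrow> cpoly" where "q s \<equiv> ffact (x (Suc n)) s"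

lemma P_eq_remove:
  assumes "j \<in> {1..n}"
  shows "P m = ffact (x j) (Poly_Mapping.lookup m j) * (\<Prod>l\<in>{1..n} - {j}. ffact (x l)
      (Poly_Mapping.lookup m l))"
  unfolding P_def using assms by (subst prod.remove[of _ j]) auto

lemma shift_rest:
  assumes "i = Suc n \<and> i' = j \<or> i = j \<and> i' = Suc n" "j \<in> {1..n}"
  shows "shift i i' (\<Prod>l\<in>{1..n} - {j}. ffact (x l) (Poly_Mapping.lookup m l)) =
    (\<Prod>l\<in>{1..n} - {j}. ffact (x l) (Poly_Mapping.lookup m l))"
proof -
  have "shift i i' (x l) = x l" if "l \<in> {1..n} - {j}" for l
    using assms that by (subst shift_x) auto
  then show ?thesis
    unfolding shift.hom_prod shift.hom_ffact by (intro prod.cong refl) simp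
qed

text \<open>Among x_1, ..., x_n this shift changes only x_j, by +1, so \<open>ffact_plus_one\<close>
  applies to a single factor.\<close>

lemma shift_P_difference:
  assumes j: "j \<in> {1..n}"
  shows "shift j (Suc n) (P m) = P m + of_nat (Poly_Mapping.lookup m j) * P (m -
      Poly_Mapping.single j 1)"
proof -
  let ?R = "\<Prod>l\<in>{1..n} - {j}. ffact (x l) (Poly_Mapping.lookup m l)"
  have "shift j (Suc n) ?R = ?R" using j by (intro shift_rest) auto
  then have "shift j (Suc n) (P m) = shift j (Suc n) (ffact (x j) (Poly_Mapping.lookup m j)) * ?R"
    by (simp only: P_eq_remove[OF j] shift.hom_mult)
  also have "shift j (Suc n) (ffact (x j) (Poly_Mapping.lookup m j)) = ffact (x j + 1)
      (Poly_Mapping.lookup m j)"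
    using j by (simp add: shift.hom_ffact shift_x)
  \<comment> \<open>At exponent 0 the truncated exponent \<open>0 - 1\<close> is harmless, since its
    coefficient is 0.\<close>
  also have "\<dots> = ffact (x j) (Poly_Mapping.lookup m j) +
      of_nat (Poly_Mapping.lookup m j) * ffact (x j) (Poly_Mapping.lookup m j - 1)"
    by (cases "Poly_Mapping.lookup m j") (simp_all only: ffact_plus_one, simp_all)
  also have "(\<dots>) * ?R = P m + of_nat (Poly_Mapping.lookup m j) * (ffact (x j) (Poly_Mapping.lookup
      m j - 1) * ?R)"
    unfolding P_eq_remove[OF j, of m] by (simp add: algebra_simps)
  also have "ffact (x j) (Poly_Mapping.lookup m j - 1) * ?R = P (m - Poly_Mapping.single j 1)"
    unfolding P_eq_remove[OF j, of "m - _"]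
    by (auto simp: lookup_minus lookup_single when_def intro!: prod.cong)
  finally show ?thesis .
qed

text \<open>A raising operator: the shift lowers x_j by 1, and the extra factor x_j completes the
  falling factorial of the next order.\<close>

lemma x_shift_P:
  assumes j: "j \<in> {1..n}"
  shows "x j * shift (Suc n) j (P m) = P (m + Poly_Mapping.single j 1)"
proof -
  let ?R = "\<Prod>l\<in>{1..n} - {j}. ffact (x l) (Poly_Mapping.lookup m l)"
  have "x j * shift (Suc n) j (P m) = x j * ffact (x j - 1) (Poly_Mapping.lookup m j) * ?R"
  proof -
    have "shift (Suc n) j ?R = ?R" using j by (intro shift_rest) auto
    moreover have "shift (Suc n) j (x j) = x j - 1" using j by (subst shift_x) auto
    ultimately show ?thesis
      by (simp only: P_eq_remove[OF j] shift.hom_mult shift.hom_ffact mult.assoc)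
  qed
  also have "x j * ffact (x j - 1) (Poly_Mapping.lookup m j) = ffact (x j) (Suc
      (Poly_Mapping.lookup m j))"
    using ffact_Suc_left[of "x j - 1"] by simp
  also have "\<dots> * ?R = P (m + Poly_Mapping.single j 1)"
    unfolding P_eq_remove[OF j, of "m + _"]
    by (auto simp: lookup_add lookup_single when_def simp del: ffact.simps intro!: prod.cong)
  finally show ?thesis .
qed

lemma exists_nonconstant_key:
  assumes "c \<in> polys n"
  obtains (const) "\<And>m. m \<in> Poly_Mapping.keys c \<Longrightarrow> m = 0"
  | (var) m j where "m \<in> Poly_Mapping.keys c" "j \<in> {1..n}" "Poly_Mapping.lookup m j > 0"
proof -
  have "m = 0" if "m \<in> Poly_Mapping.keys c" "\<forall>j\<in>{1..n}. Poly_Mapping.lookup m j = 0" for m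
    using assms that by (intro exponents_eqI[of m n 0]) (auto simp: polys_iff_keys)
  then show ?thesis using const var by (metis gr0I)
qed

text \<open>The difference in direction j removes one unit from the exponent of every key in which j
  occurs. The degree drops, and the result is nonzero because removal is injective on those keys and
  m_j is not 0.\<close>

lemma lin_ext_P_difference:
  assumes c: "c \<in> polys n" and j: "j \<in> {1..n}" and m0: "m0 \<in> Poly_Mapping.keys c"
      "Poly_Mapping.lookup m0 j > 0"
    and d: "\<And>m. m \<in> Poly_Mapping.keys c \<Longrightarrow> tdeg n m \<le> Suc d"
  obtains c' where "c' \<in> polys n" "c' \<noteq> 0" "\<And>m. m \<in> Poly_Mapping.keys c' \<Longrightarrow> tdeg n m \<le> d"
    "shift j (Suc n) (lin_ext P c) - lin_ext P c = lin_ext P c'"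
proof
  let ?e = "Poly_Mapping.single j (1::nat)"
  let ?K = "{m \<in> Poly_Mapping.keys c. Poly_Mapping.lookup m j > 0}"
  let ?t = "\<lambda>m. Poly_Mapping.single (m - ?e) (of_nat (Poly_Mapping.lookup m j) *
      Poly_Mapping.lookup c m)"
  define c' where "c' = (\<Sum>m\<in>?K. ?t m)"
  have restore: "m = (m - ?e) + ?e" if "m \<in> ?K" for m
    by (rule poly_mapping_eqI) (use that in \<open>auto simp: lookup_add lookup_minus lookup_single
        when_def\<close>)
  have keys: "\<exists>m'\<in>?K. m = m' - ?e" if "m \<in> Poly_Mapping.keys c'" for m
    using that keys_sum[of ?t ?K] by (auto simp: c'_def split: if_splits)
  show "c' \<in> polys n" unfolding polys_iff_keys
  proof
    fix m assume "m \<in> Poly_Mapping.keys c'"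
    then obtain m' where m': "m' \<in> ?K" "m = m' - ?e" using keys by blast
    then obtain m'' where "m'' \<in> exponents n" "m' = m'' + ?e"
      using c exponents_remove_single[of m' n j] by (auto simp: polys_iff_keys)
    then show "m \<in> exponents n" using m' by simp
  qed
  show "tdeg n m \<le> d" if "m \<in> Poly_Mapping.keys c'" for m
  proof -
    obtain m' where m': "m' \<in> ?K" "m = m' - ?e" using keys \<open>m \<in> Poly_Mapping.keys c'\<close> by blast
    then have "m' = m + ?e" using restore by simp
    then have "tdeg n m' = Suc (tdeg n m)" using j by simp
    then show ?thesis using d m'(1) by fastforce
  qed
  \<comment> \<open>Injectivity of the removal rules out cancellation: only the term of
    \<open>m0\<close> contributes to this coefficient.\<close>
  have "Poly_Mapping.lookup c' (m0 - ?e) = (\<Sum>m\<in>?K. if m = m0 then of_nat (Poly_Mapping.lookup m0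
      j) * Poly_Mapping.lookup c m0 else 0)"
    unfolding c'_def lookup_sum
  proof (rule sum.cong[OF refl])
    fix m assume "m \<in> ?K"
    then have "m - ?e = m0 - ?e \<longleftrightarrow> m = m0" using restore[of m] restore[of m0] m0 by auto
    then show "Poly_Mapping.lookup (?t m) (m0 - ?e) =
        (if m = m0 then of_nat (Poly_Mapping.lookup m0 j) * Poly_Mapping.lookup c m0 else 0)"
      by (auto simp: lookup_single when_def)
  qed
  also have "\<dots> \<noteq> 0" using m0 by (simp add: in_keys_iff)
  finally show "c' \<noteq> 0" by auto
  have "shift j (Suc n) (lin_ext P c) - lin_ext P c =
      (\<Sum>m\<in>Poly_Mapping.keys c. pconst (Poly_Mapping.lookup c m) * (of_nat (Poly_Mapping.lookup m
          j) * P (m - ?e)))"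
    by (simp add: lin_ext_def hom_distribs shift_P_difference[OF j] distrib_left sum.distrib)
  also have "\<dots> = (\<Sum>m\<in>?K. pconst (Poly_Mapping.lookup c m) * (of_nat (Poly_Mapping.lookup m j) * P
      (m - ?e)))"
    by (rule sum.mono_neutral_right) auto
  also have "\<dots> = lin_ext P c'"
    by (simp add: c'_def lin_ext_sum pconst_mult pconst_of_nat mult_ac)
  finally show "shift j (Suc n) (lin_ext P c) - lin_ext P c = lin_ext P c'" .
qed

lemma stable_ideal: "stable I \<Longrightarrow> Uh_ideal n I"
  by (simp add: stable_def)

lemma stable_shift:
  "stable I \<Longrightarrow> f \<in> I \<Longrightarrow> i \<in> {1..Suc n} \<Longrightarrow> j \<in> {1..Suc n} \<Longrightarrow> i \<noteq> j \<Longrightarrow> x j * shift i j f \<in> I"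
  by (simp add: stable_def)

text \<open>Applying \<open>e\<^sub>j\<^sub>,\<^sub>n\<^sub>+\<^sub>1\<close> and multiplying by \<open>x (n + 1) - s\<close> turn \<open>q s * f\<close> into \<open>q (s + 1)\<close> times a shift of
  \<open>f\<close> and times \<open>f\<close>; their difference contains a polynomial of smaller degree.\<close>

lemma stable_imp_q:
  assumes I: "stable I" and "c \<in> polys n" "c \<noteq> 0"
    and "\<And>m. m \<in> Poly_Mapping.keys c \<Longrightarrow> tdeg n m \<le> d" and "q s * lin_ext P c \<in> I"
  shows "\<exists>r\<le>d. q (s + r) \<in> I"
proof -
  have const: "q s \<in> I"
    if "c \<noteq> 0" "q s * lin_ext P c \<in> I" "\<And>m. m \<in> Poly_Mapping.keys c \<Longrightarrow> m = 0" for c s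
  proof -
    have K: "Poly_Mapping.keys c = {0}" using that(1,3) by (rule keys_eq_0)
    then have "pconst (Poly_Mapping.lookup c 0) * q s \<in> I"
      using that(2) by (simp add: lin_ext_def mult.commute)
    then show ?thesis
      using K Uh_ideal_pconst_cancel[OF stable_ideal[OF I]] by (auto simp: in_keys_iff)
  qed
  show ?thesis using assms(2-)
  proof (induction d arbitrary: c s)
    case 0
    have "m = 0" if "m \<in> Poly_Mapping.keys c" for m
      using that 0 exponents_tdeg_0[of m n] by (auto simp: polys_iff_keys)
    then show ?case using const 0 by auto
  next
    case (Suc d)
    note ideal = stable_ideal[OF I]
    show ?case
    proof (cases rule: exists_nonconstant_key[OF Suc.prems(1)])
      case 1
      then have "q (s + 0) \<in> I" using const Suc.prems by simp
      then show ?thesis by blast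
    next
      case (2 m j)
      obtain c' where c': "c' \<in> polys n" "c' \<noteq> 0" "\<And>m. m \<in> Poly_Mapping.keys c' \<Longrightarrow> tdeg n m \<le> d"
        "shift j (Suc n) (lin_ext P c) - lin_ext P c = lin_ext P c'"
        using lin_ext_P_difference[OF Suc.prems(1) 2(2,1,3) Suc.prems(3)] by metis
      have "x (Suc n) * shift j (Suc n) (q s * lin_ext P c) \<in> I"
        using 2 by (intro stable_shift[OF I Suc.prems(4)]) auto
      also have "x (Suc n) * shift j (Suc n) (q s * lin_ext P c) =
          (x (Suc n) * ffact (x (Suc n) - 1) s) * shift j (Suc n) (lin_ext P c)"
        using 2 by (simp add: shift.hom_mult shift.hom_ffact shift_x mult.assoc)
      also have "x (Suc n) * ffact (x (Suc n) - 1) s = q (Suc s)"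
        using ffact_Suc_left[of "x (Suc n) - 1" s] by simp
      finally have 1: "q (Suc s) * shift j (Suc n) (lin_ext P c) \<in> I" .
      have "(x (Suc n) - of_nat s) * (q s * lin_ext P c) \<in> I"
        by (rule Uh_ideal_mult[OF ideal _ Suc.prems(4)]) (auto simp flip: pconst_of_nat)
      also have "(x (Suc n) - of_nat s) * (q s * lin_ext P c) = q (Suc s) * lin_ext P c"
        by (simp add: mult_ac)
      finally have "q (Suc s) * shift j (Suc n) (lin_ext P c) - q (Suc s) * lin_ext P c \<in> I"
        by (rule Uh_ideal_diff[OF ideal 1])
      then have "q (Suc s) * lin_ext P c' \<in> I"
        by (simp only: c'(4)[symmetric] right_diff_distrib)
      from Suc.IH[OF c'(1-3) this] obtain r where "r \<le> d" "q (Suc s + r) \<in> I" by blast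
      then show ?thesis by (intro exI[of _ "Suc r"]) simp
    qed
  qed
qed

section \<open>Descent through the orders of falling factorial products\<close>

text \<open>With \<open>q s\<close> for the last coordinate, these are the products of total order
  \<open>r\<close> in all n + 1 coordinates.\<close>

definition level :: "cpoly set \<Rightarrow> nat \<Rightarrow> bool" where
  "level I r \<longleftrightarrow> (\<forall>m\<in>exponents n. \<forall>s. tdeg n m + s = r \<longrightarrow> P m * q s \<in> I)"

text \<open>Induction on \<open>m\<close> moves one unit of order from the last coordinate to x_k.
  Applying \<open>x k * shift (Suc n) k\<close> to \<open>P m * q (s + 1)\<close>, and multiplying
  it by x_k - m_k, give elements of \<open>I\<close> whose difference is s + 1 times the desired
  product.\<close>

lemma levelI_q:
  assumes I: "stable I" and q: "q r \<in> I"
  shows "level I r"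
  unfolding level_def
proof (intro ballI allI impI)
  note ideal = stable_ideal[OF I]
  fix m s assume "m \<in> exponents n" "tdeg n m + s = r"
  then show "P m * q s \<in> I"
  proof (induction m arbitrary: s rule: exponents_induct)
    case zero
    then show ?case using q by simp
  next
    case (add m k)
    from add.prems have prev: "P m * q (Suc s) \<in> I"
      by (intro add.IH) (use add.hyps in simp)
    let ?m = "m + Poly_Mapping.single k 1"
    have "x k * shift (Suc n) k (P m * q (Suc s)) \<in> I"
      using add.hyps by (intro stable_shift[OF I prev]) auto
    also have "x k * shift (Suc n) k (P m * q (Suc s)) =
       (x k * shift (Suc n) k (P m)) * shift (Suc n) k (q (Suc s))"
      by (simp only: shift.hom_mult mult.assoc)
    also have "shift (Suc n) k (q (Suc s)) = ffact (x (Suc n) + 1) (Suc s)"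
      unfolding shift.hom_ffact using add.hyps by (subst shift_x) auto
    also have "x k * shift (Suc n) k (P m) = P ?m" by (rule x_shift_P[OF add.hyps(2)])
    finally have 1: "P ?m * (q (Suc s) + of_nat (Suc s) * q s) \<in> I" unfolding ffact_plus_one .
    have "(x k - of_nat (Poly_Mapping.lookup m k)) * (P m * q (Suc s)) \<in> I"
      by (rule Uh_ideal_mult[OF ideal _ prev]) (use add.hyps in \<open>auto simp flip: pconst_of_nat\<close>)
    then have 2: "P ?m * q (Suc s) \<in> I" by (simp only: P_add_single[OF add.hyps(2)] mult.assoc)
    have "P ?m * (q (Suc s) + of_nat (Suc s) * q s) - P ?m * q (Suc s) = pconst (of_nat (Suc s)) *
        (P ?m * q s)"
      unfolding pconst_of_nat distrib_left by (simp only: add_diff_cancel_left' mult.left_commute)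
    then have "pconst (of_nat (Suc s)) * (P ?m * q s) \<in> I"
      using Uh_ideal_diff[OF ideal 1 2] by simp
    then show "P ?m * q s \<in> I" by (rule Uh_ideal_pconst_cancel[OF ideal]) (simp del: of_nat_Suc)
  qed
qed

text \<open>Since the \<open>x j\<close> add up to \<open>N\<close>, the products of level \<open>r + 1\<close> obtained from one of level \<open>r\<close> add up to
  \<open>N - r\<close> times that product.\<close>

lemma level_descend:
  assumes I: "stable I" and lev: "level I (Suc r)" and r: "r \<noteq> N"
  shows "level I r"
  unfolding level_def
proof (intro ballI allI impI)
  note ideal = stable_ideal[OF I]
  fix m s assume m: "m \<in> exponents n" "tdeg n m + s = r"
  have "(\<Sum>j=1..n. P (m + Poly_Mapping.single j 1) * q s) + P m * q (Suc s) \<in> I"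
  proof -
    have "P (m + Poly_Mapping.single j 1) * q s \<in> I" if "j \<in> {1..n}" for j
    proof -
      have "m + Poly_Mapping.single j 1 \<in> exponents n" "tdeg n (m + Poly_Mapping.single j 1) + s =
          Suc r"
        using m that by auto
      then show ?thesis using lev unfolding level_def by blast
    qed
    then have "(\<Sum>j=1..n. P (m + Poly_Mapping.single j 1) * q s) \<in> I"
      by (rule Uh_ideal_sum[OF ideal])
    moreover have "P m * q (Suc s) \<in> I"
      using lev m unfolding level_def by (metis add_Suc_right)
    ultimately show ?thesis by (rule Uh_idealD(3)[OF ideal])
  qed
  also have "(\<Sum>j=1..n. P (m + Poly_Mapping.single j 1) * q s) =
     (\<Sum>j=1..n. (x j - of_nat (Poly_Mapping.lookup m j)) * (P m * q s))"
    by (rule sum.cong) (simp_all only: P_add_single mult.assoc)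
  also have "\<dots> = ((\<Sum>j=1..n. x j) - of_nat (tdeg n m)) * (P m * q s)"
    by (simp add: sum_distrib_right[symmetric] sum_subtractf tdeg_def)
  also have "(\<Sum>j=1..n. x j) = of_nat N - x (Suc n)"
    using sum_x by (simp add: eq_diff_eq)
  also have "(of_nat N - x (Suc n) - of_nat (tdeg n m)) * (P m * q s) + P m * q (Suc s) =
      (of_nat N - of_nat (tdeg n m + s)) * (P m * q s)"
    by (simp add: algebra_simps)
  also have "of_nat N - of_nat (tdeg n m + s) = pconst (of_nat N - of_nat r)"
    by (simp only: m(2) pconst.hom_minus pconst_of_nat)
  finally show "P m * q s \<in> I"
    by (rule Uh_ideal_pconst_cancel[OF ideal]) (use r in auto)
qed

lemma level_zero: "level I 0 \<Longrightarrow> stable I \<Longrightarrow> I = polys n"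
proof (rule Uh_ideal_eq_polys)
  assume "level I 0"
  then have "P 0 * q 0 \<in> I" unfolding level_def by (metis add_0 tdeg_zero zero_in_exponents)
  then show "1 \<in> I" by simp
qed (rule stable_ideal)

text \<open>Descending from an order at most \<open>N\<close>, every order reached is below
  \<open>N\<close>, so \<open>level_descend\<close> applies down to 0.\<close>

lemma level_le:
  assumes "stable I" "level I r" "r \<le> N"
  shows "I = polys n"
proof -
  have "level I 0"
    using assms(2,3) by (induction r) (use level_descend[OF assms(1)] in auto)
  then show ?thesis using level_zero assms(1) by blast
qed

text \<open>Here the descent reaches N + 1 and stops, because the scalar in the step from N + 1 to
  \<open>N\<close> is zero.\<close>

lemma level_gt:
  assumes "stable I" "level I r" "r > N"
  shows "level I (Suc N)"
proof -
  have "level I (Suc N + d) \<Longrightarrow> level I (Suc N)" for d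
    by (induction d) (use level_descend[OF assms(1)] in auto)
  then show ?thesis using assms(2,3) by (metis Suc_leI le_Suc_ex)
qed

text \<open>By \<open>lin_ext_P_vanishing\<close> elements of \<open>W\<close> involve only products
  of degree above \<open>N\<close>, and \<open>P_add_single\<close> makes each of these a multiple
  of one of degree N + 1. This yields both minimality and finite generation.\<close>

lemma W_subset:
  assumes ideal: "Uh_ideal n I" and gen: "\<And>m. m \<in> exponents n \<Longrightarrow> tdeg n m = Suc N \<Longrightarrow> P m \<in> I"
  shows "W \<subseteq> I"
proof
  have P: "P m \<in> I" if "m \<in> exponents n" "tdeg n m > N" for m
    using that
  proof (induction m rule: exponents_induct)
    case (add m k)
    show ?case
    proof (cases "tdeg n m > N")
      case True
      show ?thesis unfolding P_add_single[OF add.hyps(2)]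
        by (rule Uh_ideal_mult[OF ideal]) (use True add in \<open>auto simp flip: pconst_of_nat\<close>)
    next
      case False
      then show ?thesis using add by (intro gen) auto
    qed
  qed simp
  fix f assume f: "f \<in> W"
  then have "f \<in> polys n" by (simp add: W_def)
  then obtain c where c: "c \<in> polys n" "f = lin_ext P c" by (rule polys_expansion)
  have "tdeg n m > N" if "m \<in> Poly_Mapping.keys c" for m
    by (rule lin_ext_P_vanishing[OF c(1) _ that]) (use f c(2) in \<open>auto simp: W_def\<close>)
  then show "f \<in> I"
    unfolding c(2) lin_ext_def using c(1) P
    by (intro Uh_ideal_sum[OF ideal] Uh_ideal_scale[OF ideal]) (auto simp: polys_iff_keys)
qed

lemma W_subset_of_level:
  assumes "stable I" and lev: "level I (Suc N)"
  shows "W \<subseteq> I"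
proof (rule W_subset[OF stable_ideal[OF assms(1)]])
  fix m assume "m \<in> exponents n" "tdeg n m = Suc N"
  then have "P m * q 0 \<in> I" using lev unfolding level_def by (metis add_0_right)
  then show "P m \<in> I" by simp
qed

text \<open>The bound \<open>d > N\<close> in the second alternative is what
  \<open>W_maximal\<close> exploits: an element of degree at most \<open>N\<close> forces the whole
  ring.\<close>

lemma stable_cases:
  assumes I: "stable I" and c: "c \<in> polys n" "c \<noteq> 0" "lin_ext P c \<in> I"
    and d: "\<And>m. m \<in> Poly_Mapping.keys c \<Longrightarrow> tdeg n m \<le> d"
  shows "I = polys n \<or> d > N \<and> W \<subseteq> I"
proof -
  obtain r where r: "r \<le> d" "q r \<in> I"
    using stable_imp_q[OF I c(1,2) d, of 0] c(3) by auto
  then have "level I r" using levelI_q[OF I] by blast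
  then show ?thesis using level_le[OF I] level_gt[OF I] W_subset_of_level[OF I] r(1)
    by (meson leD le_less_trans not_le)
qed

section \<open>\<open>W\<close> as the only nonzero proper stable ideal\<close>

lemma W_minimal:
  assumes I: "stable I" and nz: "I \<noteq> {0}"
  shows "W \<subseteq> I"
proof -
  obtain f where f: "f \<in> I" "f \<noteq> 0" using nz Uh_idealD(2)[OF stable_ideal[OF I]] by blast
  from Uh_idealD(1)[OF stable_ideal[OF I] f(1)]
  obtain c where c: "c \<in> polys n" "f = lin_ext P c" by (rule polys_expansion)
  have "c \<noteq> 0" using f c by auto
  \<comment> \<open>Any degree bound will do; the sum of all degrees is a convenient one.\<close>
  have "tdeg n m \<le> (\<Sum>m\<in>Poly_Mapping.keys c. tdeg n m)" if "m \<in> Poly_Mapping.keys c" for m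
    using that by (intro member_le_sum) auto
  from stable_cases[OF I c(1) \<open>c \<noteq> 0\<close> _ this] show ?thesis
    using f c(2) by (auto simp: W_def)
qed

text \<open>Take \<open>f\<close> in \<open>I\<close> outside \<open>W\<close> and drop its terms of
  degree above \<open>N\<close>, which lie in \<open>W\<close>. The remainder is nonzero, still in
  \<open>I\<close>, and of degree at most \<open>N\<close>.\<close>

lemma W_maximal:
  assumes I: "stable I" and "W \<subseteq> I" "I \<noteq> W"
  shows "I = polys n"
proof -
  note ideal = stable_ideal[OF I]
  obtain f where f: "f \<in> I" "f \<notin> W" using assms(2,3) by blast
  from Uh_idealD(1)[OF ideal f(1)]
  obtain c where c: "c \<in> polys n" "f = lin_ext P c" by (rule polys_expansion)
  let ?low = "{m \<in> Poly_Mapping.keys c. tdeg n m \<le> N}"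
  let ?high = "{m \<in> Poly_Mapping.keys c. tdeg n m > N}"
  define c' where "c' = (\<Sum>m\<in>?low. Poly_Mapping.single m (Poly_Mapping.lookup c m))"
  have keys: "Poly_Mapping.keys c' \<subseteq> ?low"
    unfolding c'_def by (rule order_trans[OF keys_sum]) (simp split: if_splits)
  have c'p: "c' \<in> polys n" using keys c(1) unfolding polys_iff_keys by blast
  have low: "lin_ext P c' = (\<Sum>m\<in>?low. pconst (Poly_Mapping.lookup c m) * P m)"
    by (simp add: c'_def lin_ext_sum)
  have "f = lin_ext P c' + (\<Sum>m\<in>?high. pconst (Poly_Mapping.lookup c m) * P m)"
  proof -
    have "f = (\<Sum>m\<in>?low \<union> ?high. pconst (Poly_Mapping.lookup c m) * P m)"
      unfolding c(2) lin_ext_def by (rule sum.cong) auto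
    also have "\<dots> = lin_ext P c' + (\<Sum>m\<in>?high. pconst (Poly_Mapping.lookup c m) * P m)"
      unfolding low by (rule sum.union_disjoint) auto
    finally show ?thesis .
  qed
  moreover have high: "(\<Sum>m\<in>?high. pconst (Poly_Mapping.lookup c m) * P m) \<in> W"
  proof (rule Uh_ideal_sum[OF stable_ideal[OF W_stable]])
    fix m assume "m \<in> ?high"
    then have "P m \<in> W" using c(1) by (intro P_in_W) (auto simp: polys_iff_keys)
    then show "pconst (Poly_Mapping.lookup c m) * P m \<in> W"
      by (rule Uh_ideal_scale[OF stable_ideal[OF W_stable]])
  qed
  ultimately have eq: "lin_ext P c' = f - (\<Sum>m\<in>?high. pconst (Poly_Mapping.lookup c m) * P m)" by
      simp
  have mem: "lin_ext P c' \<in> I"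
    unfolding eq by (rule Uh_ideal_diff[OF ideal f(1) subsetD[OF assms(2) high]])
  have "c' \<noteq> 0"
  proof
    assume "c' = 0"
    then have "f = (\<Sum>m\<in>?high. pconst (Poly_Mapping.lookup c m) * P m)" using eq by simp
    then show False using high f(2) by simp
  qed
  have "tdeg n m \<le> N" if "m \<in> Poly_Mapping.keys c'" for m using that keys by blast
  from stable_cases[OF I c'p \<open>c' \<noteq> 0\<close> mem this] show ?thesis by simp
qed

lemma one_notin_W: "1 \<notin> W"
proof
  assume "1 \<in> W"
  then have "\<forall>m\<in>exponents n. \<not> tdeg n m \<le> N" by (simp add: W_def)
  from bspec[OF this zero_in_exponents] show False by simp
qed

lemma W_neq_zero: "W \<noteq> {0}"
proof -
  let ?m = "Poly_Mapping.single 1 (Suc N)"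
  have m: "?m \<in> exponents n" "tdeg n ?m > N"
    using n_pos add_single_in_exponents[of 0 n 1 "Suc N"] tdeg_add_single[of 1 n 0 "Suc N"] by
        simp_all
  have "P ?m \<noteq> 0" using ev_P_same[of ?m] by (metis ev.hom_zero)
  then show ?thesis using P_in_W[OF m] by blast
qed

lemma nonzero_proper_submodule_iff: "nonzero_proper_submodule n (M_rep n b) I \<longleftrightarrow> I = W"
proof
  assume "nonzero_proper_submodule n (M_rep n b) I"
  then have I: "stable I" "I \<noteq> {0}" "I \<noteq> polys n"
    by (simp_all add: nonzero_proper_submodule_def sl_submodule_iff_stable)
  then have "W \<subseteq> I" by (intro W_minimal)
  then show "I = W" using W_maximal[OF I(1)] I(3) by blast
next
  assume I: "I = W"
  have "W \<noteq> polys n" using one_notin_W one_in_polys by metis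
  then show "nonzero_proper_submodule n (M_rep n b) I"
    using W_stable W_neq_zero unfolding I by (simp add: nonzero_proper_submodule_def
        sl_submodule_iff_stable)
qed

end

section \<open>The restriction to the Cartan subalgebra\<close>

text \<open>The last entry is a slack variable that turns the bound on the degree into an equation,
  as in stars and bars.\<close>

definition exps_list :: "nat \<Rightarrow> nat \<Rightarrow> (nat \<Rightarrow>\<^sub>0 nat) \<Rightarrow> nat list" where
  "exps_list n d m = map (Poly_Mapping.lookup m) [1..<Suc n] @ [d - tdeg n m]"

lemma sum_list_exps: "sum_list (map (Poly_Mapping.lookup m) [1..<Suc n]) = tdeg n m"
  by (simp add: tdeg_def interv_sum_list_conv_sum_set_nat atLeastLessThanSuc_atLeastAtMost del:
      upt_Suc)

lemma lookup_sum_single: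
  fixes k n :: nat
  assumes "k \<in> {1..n}"
  shows "Poly_Mapping.lookup (\<Sum>k=1..n. Poly_Mapping.single k (f k)) k = (f k :: nat)"
  using assms by (simp add: lookup_sum lookup_single when_def)

lemma bij_betw_exps_list:
  "bij_betw (exps_list n d) {m \<in> exponents n. tdeg n m \<le> d} {l. length l = Suc n \<and> sum_list l = d}"
proof (rule bij_betwI')
  fix m m' assume m: "m \<in> {m \<in> exponents n. tdeg n m \<le> d}" and m': "m' \<in> {m \<in> exponents n. tdeg n
      m \<le> d}"
  show "exps_list n d m = exps_list n d m' \<longleftrightarrow> m = m'"
  proof
    assume "exps_list n d m = exps_list n d m'"
    then have "\<forall>k\<in>set [1..<Suc n]. Poly_Mapping.lookup m k = Poly_Mapping.lookup m' k"
      by (simp add: exps_list_def del: upt_Suc)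
    then have "Poly_Mapping.lookup m k = Poly_Mapping.lookup m' k" if "k \<in> {1..n}" for k
      using that by (simp del: upt_Suc)
    then show "m = m'" using m m' by (intro exponents_eqI[of m n m']) blast+
  qed simp
next
  fix m assume "m \<in> {m \<in> exponents n. tdeg n m \<le> d}"
  then show "exps_list n d m \<in> {l. length l = Suc n \<and> sum_list l = d}"
    unfolding exps_list_def mem_Collect_eq sum_list_append sum_list_exps by (simp del: upt_Suc)
next
  fix l assume "l \<in> {l. length l = Suc n \<and> sum_list l = d}"
  then have l: "length l = Suc n" "sum_list l = d" by auto
  define m where "m = (\<Sum>k=1..n. Poly_Mapping.single k (l ! (k - 1)))"
  have lookup: "Poly_Mapping.lookup m k = l ! (k - 1)" if "k \<in> {1..n}" for k
    using lookup_sum_single[OF that] by (simp add: m_def)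
  have "Poly_Mapping.keys m \<subseteq> (\<Union>k\<in>{1..n}. Poly_Mapping.keys (Poly_Mapping.single k (l ! (k - 1))))"
    unfolding m_def by (rule keys_sum)
  then have m: "m \<in> exponents n" by (auto simp: exponents_def split: if_splits)
  have "map (Poly_Mapping.lookup m) [1..<Suc n] = take n l"
    using l by (intro nth_equalityI) (auto simp: lookup simp del: upt_Suc)
  moreover have "l = take n l @ [l ! n]"
    using l take_Suc_conv_app_nth[of n l] by simp
  ultimately have "l = map (Poly_Mapping.lookup m) [1..<Suc n] @ [l ! n]" by simp
  moreover from this have "d = tdeg n m + l ! n"
    using l(2) sum_list_exps[of m n] by (metis add.right_neutral sum_list.Cons sum_list.Nil
        sum_list_append)
  ultimately show "\<exists>m\<in>{m \<in> exponents n. tdeg n m \<le> d}. l = exps_list n d m"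
    using m by (intro bexI[of _ m]) (auto simp: exps_list_def)
qed

lemma card_exponents: "card {m \<in> exponents n. tdeg n m \<le> d} = (d + n) choose n"
  using bij_betw_same_card[OF bij_betw_exps_list[of n d]] card_length_sum_list[of "Suc n" d]
    binomial_symmetric[of n "d + n"] by simp

lemma finite_exponents: "finite {m \<in> exponents n. tdeg n m \<le> d}"
  \<comment> \<open>An infinite set would have cardinality 0, while this binomial coefficient is
    positive.\<close>
  by (rule card_ge_0_finite) (simp add: card_exponents)

section \<open>\<open>W\<close> as a module over the polynomial ring\<close>

lemma cring_Uh_ring: "cring (Uh_ring n)"
proof (rule cringI)
  show "abelian_group (Uh_ring n)"
    by (rule abelian_groupI) (auto simp: Uh_ring_def algebra_simps intro: bexI[of _ "- _"])
  show "comm_monoid (Uh_ring n)"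
    by unfold_locales (auto simp: Uh_ring_def mult_ac)
qed (auto simp: Uh_ring_def algebra_simps)

lemma finsum_eq_sum:
  fixes G (structure)
  assumes "abelian_monoid G" "add G = (+)" "\<zero> = 0" "\<And>a. a \<in> A \<Longrightarrow> f a \<in> carrier G"
  shows "finsum G f A = sum f A"
proof -
  interpret abelian_monoid G by fact
  show ?thesis using assms(4)
    by (induction A rule: infinite_finite_induct) (simp_all add: assms(2,3) Pi_def)
qed

context weight_module
begin

lemma W_submodule: "sl_submodule n (M_rep n b) W"
  by (simp add: sl_submodule_iff_stable W_stable)

lemma W_ideal: "Uh_ideal n W"
  by (rule stable_ideal[OF W_stable])

lemma monom_act_W:
  assumes "m \<in> exponents n"
  shows "monom_act n (sub_rep (M_rep n b) W) m v = Poly_Mapping.single m 1 * v"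
proof -
  have "fold (\<lambda>k. M_act n b (h_mat n k) ^^ Poly_Mapping.lookup m k) [1..<Suc r] v =
      (\<Prod>k=1..r. hvar k ^ Poly_Mapping.lookup m k) * v" if "r \<le> n" for r
    using that
  proof (induction r)
    case (Suc r)
    have "M_act n b (h_mat n (Suc r)) = (*) (hvar (Suc r))"
      using Suc.prems by (auto simp: M_act_h_mat)
    moreover have "((*) y ^^ e) f = y ^ e * f" for y f :: cpoly and e
      by (induction e) (simp_all add: mult.assoc)
    ultimately show ?case using Suc by (simp add: mult_ac)
  qed simp
  from this[of n] have "monom_act n (sub_rep (M_rep n b) W) m v = (\<Prod>k=1..n. hvar k ^
      Poly_Mapping.lookup m k) * v"
    by (simp add: monom_act_def)
  also have "(\<Prod>k=1..n. hvar k ^ Poly_Mapping.lookup m k) =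
      (\<Prod>k\<in>Poly_Mapping.keys m. hvar k ^ Poly_Mapping.lookup m k)"
    using assms by (intro prod.mono_neutral_right) (auto simp: exponents_def in_keys_iff)
  finally show ?thesis by (simp add: prod_single_eq)
qed

text \<open>The restriction of \<open>W\<close> to the Cartan subalgebra is thus the ideal
  \<open>W\<close> with ordinary multiplication, and finiteness and freeness become questions about
  ideals.\<close>

lemma poly_act_W:
  assumes p: "p \<in> polys n" and v: "v \<in> W"
  shows "poly_act n (sub_rep (M_rep n b) W) p v = p * v"
proof -
  interpret V: sl_module n "sub_rep (M_rep n b) W"
    by (rule sl_module_sub_rep[OF sl_module_M_rep W_submodule])
  have in_polys: "Poly_Mapping.single m c \<in> polys n" if "m \<in> Poly_Mapping.keys p" for m c
    using p that by (auto simp: polys_iff_keys)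
  have "poly_act n (sub_rep (M_rep n b) W) p v =
      (\<Oplus>\<^bsub>sub_rep (M_rep n b) W\<^esub>m\<in>Poly_Mapping.keys p. Poly_Mapping.single m (Poly_Mapping.lookup p
          m) * v)"
    unfolding poly_act_def
  proof (rule V.M.finsum_cong')
    fix m assume "m \<in> Poly_Mapping.keys p"
    then have "m \<in> exponents n" using p by (auto simp: polys_iff_keys)
    then show "Poly_Mapping.lookup p m \<odot>\<^bsub>sub_rep (M_rep n b) W\<^esub> monom_act n (sub_rep (M_rep n b)
        W) m v =
      Poly_Mapping.single m (Poly_Mapping.lookup p m) * v"
      by (simp add: monom_act_W pconst_def mult_single flip: mult.assoc)
  qed (use in_polys Uh_ideal_mult[OF W_ideal _ v] in auto)
  also have "\<dots> = (\<Sum>m\<in>Poly_Mapping.keys p. Poly_Mapping.single m (Poly_Mapping.lookup p m) * v)"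
    by (rule finsum_eq_sum[OF V.M.abelian_monoid_axioms])
      (use in_polys Uh_ideal_mult[OF W_ideal _ v] in auto)
  also have "\<dots> = p * v" by (simp add: sum_distrib_right[symmetric] sum_single_eq)
  finally show ?thesis .
qed

abbreviation W_res :: "(cpoly, cpoly) module" where
  "W_res \<equiv> res_cartan n (sub_rep (M_rep n b) W)"

lemma W_res_simps:
  "carrier W_res = W" "\<zero>\<^bsub>W_res\<^esub> = 0" "add W_res = (+)"
  "p \<in> polys n \<Longrightarrow> v \<in> W \<Longrightarrow> p \<odot>\<^bsub>W_res\<^esub> v = p * v"
  by (simp_all add: res_cartan_def poly_act_W)

lemma module_W_res: "Module.module (Uh_ring n) W_res"
proof (rule module_criteria[OF cring_Uh_ring])
  note I = Uh_idealD[OF W_ideal] Uh_ideal_mult[OF W_ideal]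
  have "f + - f = 0 \<and> - f \<in> W" if "f \<in> W" for f
    using Uh_ideal_diff[OF W_ideal I(2) that] by simp
  then show "\<forall>v\<in>carrier W_res. \<exists>w\<in>carrier W_res. v \<oplus>\<^bsub>W_res\<^esub> w = \<zero>\<^bsub>W_res\<^esub>"
    unfolding W_res_simps by blast
qed (use Uh_idealD[OF W_ideal] Uh_ideal_mult[OF W_ideal] in
    \<open>auto simp: W_res_simps Uh_ring_def algebra_simps\<close>)

text \<open>For applying \<open>W_subset\<close> to a span.\<close>

lemma submodule_imp_Uh_ideal:
  assumes "submodule (Uh_ring n) I W_res"
  shows "Uh_ideal n I"
proof -
  interpret submodule "(Uh_ring n)" I W_res by fact
  have W: "I \<subseteq> W" using subset by (simp add: W_res_simps)
  have mult: "p * f \<in> I" if "p \<in> polys n" "f \<in> I" for p f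
  proof -
    have "p \<odot>\<^bsub>W_res\<^esub> f \<in> I" using that by (intro smult_closed) (simp_all add: Uh_ring_def)
    then show ?thesis using W that by (simp add: W_res_simps(4) subset_iff)
  qed
  show ?thesis
    using W Uh_idealD(1)[OF W_ideal] mult m_closed zero_closed
    unfolding Uh_ideal_def by (auto simp: W_res_simps)
qed

lemma finitely_generated_W: "finitely_generated (Uh_ring n) W_res"
  unfolding finitely_generated_def
proof (intro exI conjI)
  interpret R: Module.module "(Uh_ring n)" W_res by (rule module_W_res)
  let ?S = "P ` {m \<in> exponents n. tdeg n m = Suc N}"
  have "finite {m \<in> exponents n. tdeg n m = Suc N}"
    by (rule finite_subset[OF _ finite_exponents[of n "Suc N"]]) auto
  then show "finite ?S" by simp
  show S: "?S \<subseteq> carrier W_res" by (auto simp: W_res_simps intro: P_in_W)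
  have "W \<subseteq> R.span ?S"
  proof (rule W_subset)
    show "Uh_ideal n (R.span ?S)"
      by (rule submodule_imp_Uh_ideal[OF R.span_is_submodule[OF S]])
    show "P m \<in> R.span ?S" if "m \<in> exponents n" "tdeg n m = Suc N" for m
      using R.in_own_span[OF S] that by blast
  qed
  then show "R.span ?S = carrier W_res"
    using R.span_is_subset2[OF S] by (simp add: W_res_simps)
qed

text \<open>The span of the single basis element \<open>g\<close> lies in the submodule of its
  polynomial multiples.\<close>

lemma free_of_rank_1_imp_principal:
  assumes "free_of_rank (Uh_ring n) W_res 1"
  obtains g where "g \<in> W" "\<And>f. f \<in> W \<Longrightarrow> \<exists>p. f = p * g"
proof -
  interpret R: Module.module "(Uh_ring n)" W_res by (rule module_W_res)
  obtain B where "card B = 1" and B: "B \<subseteq> carrier W_res" "R.span B = carrier W_res"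
    using assms unfolding free_of_rank_def by blast
  then obtain g where g: "B = {g}" by (meson card_1_singletonE)
  have gW: "g \<in> W" using B(1) g by (simp add: W_res_simps)
  let ?J = "(\<lambda>p. p * g) ` polys n"
  have "?J \<subseteq> W" using Uh_ideal_mult[OF W_ideal _ gW] by blast
  have "submodule (Uh_ring n) ?J W_res"
  proof (intro submodule.intro)
    show "Module.module (Uh_ring n) W_res" by (rule module_W_res)
    show "?J \<subseteq> carrier W_res" using \<open>?J \<subseteq> W\<close> by (simp add: W_res_simps)
    show "v \<oplus>\<^bsub>W_res\<^esub> w \<in> ?J" if "v \<in> ?J" "w \<in> ?J" for v w
      using that by (auto simp: W_res_simps simp flip: distrib_right)
    show "\<zero>\<^bsub>W_res\<^esub> \<in> ?J" by (rule image_eqI[of _ _ 0]) (simp_all add: W_res_simps)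
    fix p v assume p: "p \<in> carrier (Uh_ring n)" and v: "v \<in> ?J"
    then obtain p' where p': "p' \<in> polys n" "v = p' * g" by blast
    have "v \<in> W" using v \<open>?J \<subseteq> W\<close> by blast
    then have "p \<odot>\<^bsub>W_res\<^esub> v = (p * p') * g" using p p' by (simp add: Uh_ring_def W_res_simps
        mult.assoc)
    then show "p \<odot>\<^bsub>W_res\<^esub> v \<in> ?J" using p p' by (auto simp: Uh_ring_def)
  qed
  moreover have "B \<subseteq> ?J" unfolding g using image_eqI[of g "\<lambda>p. p * g" 1] by simp
  ultimately have "R.span B \<subseteq> ?J" by (intro R.span_is_subset)
  then have "W \<subseteq> ?J" unfolding B(2) by (simp add: W_res_simps)
  then have "\<exists>p. f = p * g" if "f \<in> W" for f using that by blast
  then show ?thesis using that gW by blast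
qed

lemma P_single: "P (Poly_Mapping.single j k) = ffact (x j) k" if "j \<in> {1..n}"
proof -
  have "(\<Prod>l\<in>{1..n} - {j}. ffact (x l) (Poly_Mapping.lookup (Poly_Mapping.single j k) l)) = 1"
    by (rule prod.neutral) (auto simp: lookup_single when_def)
  then show ?thesis unfolding P_eq_remove[OF that] by simp
qed

text \<open>Every factor is a negative integer; the product is k! up to sign.\<close>

lemma ffact_minus_one_neq_0: "ffact (- 1) k \<noteq> (0::cpoly)"
proof (induction k)
  case (Suc k)
  have "- 1 - of_nat k = - (of_nat (Suc k) :: cpoly)" by simp
  then have "- 1 - of_nat k \<noteq> (0::cpoly)" by (metis neg_equal_0_iff_equal of_nat_neq_0)
  then show ?case using Suc by simp
qed simp

text \<open>On the axis of the coordinate \<open>x j\<close> the polynomial \<open>ffact (x j) (N + 1)\<close> has a simple zero at the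
  origin, which is already a zero of \<open>g\<close>, while \<open>ffact (x k) (N + 1)\<close> vanishes.\<close>

lemma common_divisor_axis:
  assumes jk: "j \<in> {1..n}" "k \<in> {1..n}" "j \<noteq> k" and g: "ev b 0 g = 0"
    and p: "ffact (x j) (Suc N) = p * g" and r: "ffact (x k) (Suc N) = r * g"
  shows "ev b 0 p \<noteq> 0 \<and> ev b 0 r = 0"
proof -
  \<comment> \<open>Restriction to the axis of \<open>x j\<close>: every other variable is set to
    b.\<close>
  define \<phi> where "\<phi> = poly_subst (\<lambda>i. if i = j then hvar j else pconst b)"
  interpret \<phi>: comm_ring_hom \<phi> unfolding \<phi>_def by unfold_locales
  define t where "t = pconst b - hvar j"
  have t0: "ev b 0 t = 0" by (simp add: t_def ev_def hom_distribs)
  have "hvar j \<noteq> pconst b"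
  proof
    assume "hvar j = pconst b"
    then have "Poly_Mapping.lookup (hvar j) (Poly_Mapping.single j 1) =
      Poly_Mapping.lookup (pconst b) (Poly_Mapping.single j 1)" by simp
    moreover have "Poly_Mapping.single j (1::nat) \<noteq> 0" by (metis lookup_single_eq lookup_zero
        zero_neq_one)
    ultimately show False by (simp add: hvar_def pconst_def lookup_single when_def)
  qed
  then have t: "t \<noteq> 0" by (simp add: t_def)
  have xs: "\<phi> (x j) = t" "\<phi> (x k) = 0"
    using jk by (auto simp: x_def t_def \<phi>_def hom_distribs)
  have ev_\<phi>: "ev b 0 (\<phi> f) = ev b 0 f" for f
  proof -
    have "(\<lambda>i. poly_subst (\<lambda>l. pconst (b - of_nat (Poly_Mapping.lookup 0 l))) (if i = j then hvar
        j else pconst b))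
        = (\<lambda>i. pconst (b - of_nat (Poly_Mapping.lookup 0 i)))" by auto
    then show ?thesis unfolding ev_def \<phi>_def poly_subst_comp by simp
  qed
  \<comment> \<open>On the axis a polynomial is its value at the origin plus a multiple of the axis
    coordinate \<open>t\<close>.\<close>
  have "\<exists>h. \<phi> f = ev b 0 f + t * h" for f
  proof (induction f rule: polynomial_induct)
    case (const c)
    show ?case by (rule exI[of _ 0]) (simp add: \<phi>_def)
  next
    case (var i)
    show ?case
      by (rule exI[of _ "if i = j then - 1 else 0"]) (simp add: \<phi>_def ev_def t_def)
  next
    case (add f f')
    then obtain h h' where "\<phi> f = ev b 0 f + t * h" "\<phi> f' = ev b 0 f' + t * h'" by blast
    then show ?case by (intro exI[of _ "h + h'"]) (simp add: hom_distribs algebra_simps)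
  next
    case (mult f f')
    then obtain h h' where "\<phi> f = ev b 0 f + t * h" "\<phi> f' = ev b 0 f' + t * h'" by blast
    then show ?case
      by (intro exI[of _ "ev b 0 f * h' + h * ev b 0 f' + t * h * h'"]) (simp add: hom_distribs
          algebra_simps)
  qed
  from this[of g] obtain h where h: "\<phi> g = t * h" using g by auto
  have "t * ffact (t - 1) N = ffact t (Suc N)" using ffact_Suc_left[of "t - 1" N] by simp
  also have "\<dots> = t * (\<phi> p * h)"
    using arg_cong[OF p, of \<phi>] by (simp add: \<phi>.hom_ffact xs h hom_distribs mult_ac del: ffact.simps)
  \<comment> \<open>One factor \<open>t\<close> cancels. At the origin the left side becomes
    \<open>ffact (- 1) N\<close>, which is nonzero, so \<open>p\<close> cannot vanish there.\<close>
  finally have ph: "ffact (t - 1) N = \<phi> p * h" using t by simp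
  have "ffact (- 1) N = ev b 0 p * ev b 0 h"
    using arg_cong[OF ph, of "ev b 0"] by (simp add: ev.hom_ffact hom_distribs t0 ev_\<phi>)
  then have p0: "ev b 0 p \<noteq> 0" and "h \<noteq> 0" using ffact_minus_one_neq_0[of N] by auto
  then have "\<phi> g \<noteq> 0" using h t by simp
  moreover have "ffact (0::cpoly) (Suc N) = 0"
    using ffact_of_nat_eq_0_iff[of 0 "Suc N", where 'a = cpoly] by simp
  then have "\<phi> r * \<phi> g = 0"
    using arg_cong[OF r, of \<phi>] by (simp add: \<phi>.hom_ffact xs hom_distribs del: ffact.simps)
  ultimately have "\<phi> r = 0" by simp
  then show ?thesis using p0 ev_\<phi>[of r] by simp
qed

text \<open>Using the axes 1 and 2 in both orders makes \<open>p\<close> both nonzero and zero at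
  the origin. For n = 1 there is one exponent of degree N + 1, so \<open>W\<close> is generated by
  \<open>ffact (x 1) (Suc N)\<close> and is free of rank 1.\<close>

lemma not_free_W:
  assumes "n \<ge> 2"
  shows "\<not> free_of_rank (Uh_ring n) W_res 1"
proof
  assume "free_of_rank (Uh_ring n) W_res 1"
  then obtain g where g: "g \<in> W" "\<And>f. f \<in> W \<Longrightarrow> \<exists>p. f = p * g"
    using free_of_rank_1_imp_principal by blast
  have "ev b 0 g = 0" using g(1) by (simp add: W_def)
  have "\<exists>p. ffact (x j) (Suc N) = p * g" if "j \<in> {1..n}" for j
  proof -
    have "P (Poly_Mapping.single j (Suc N)) \<in> W"
      using add_single_in_exponents[of 0 n j "Suc N"] tdeg_add_single[of j n 0 "Suc N"] that
      by (intro P_in_W) simp_all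
    then show ?thesis using g(2) P_single[OF that] by simp
  qed
  from this[of 1] this[of 2] obtain p r
    where "ffact (x 1) (Suc N) = p * g" "ffact (x 2) (Suc N) = r * g" using assms by auto
  then show False
    using common_divisor_axis[of 1 2 g p r] common_divisor_axis[of 2 1 g r p] \<open>ev b 0 g = 0\<close> assms
        by simp
qed


subsection \<open>The finite dimensional quotient\<close>

sublocale Q: sl_quotient n "M_rep n b" W
  by (intro sl_quotient.intro sl_quotient_axioms.intro sl_module_M_rep W_submodule)

abbreviation quot :: "cpoly set lie_rep" where "quot \<equiv> quot_rep (M_rep n b) W"

lemma sl_module_quot: "sl_module n quot"
  by (rule Q.sl_module_quot_rep)

lemma coset_eq:
  assumes "f \<in> polys n" "g \<in> polys n" "f - g \<in> W"
  shows "Q.coset f = Q.coset g"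
proof (rule Q.coset_eqI)
  show "f \<in> Q.coset g"
    unfolding a_r_coset_def' using assms(3) by (auto intro!: bexI[of _ "f - g"])
qed (use assms in simp)

lemma coset_eq_W: "f \<in> polys n \<Longrightarrow> Q.coset f = W \<longleftrightarrow> f \<in> W"
  using Q.coset_eq_W_iff by simp

abbreviation low :: "(nat \<Rightarrow>\<^sub>0 nat) set" where "low \<equiv> {m \<in> exponents n. tdeg n m \<le> N}"

text \<open>A combination in \<open>W\<close> may involve only degrees above \<open>N\<close>,
  whereas all terms here have degree at most \<open>N\<close>.\<close>

lemma combination_in_W:
  assumes "(\<Sum>m\<in>low. pconst (a m) * P m) \<in> W" "m \<in> low"
  shows "a m = 0"
proof (rule ccontr)
  assume "a m \<noteq> 0"
  define c where "c = (\<Sum>m\<in>low. Poly_Mapping.single m (a m))"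
  have lookup: "Poly_Mapping.lookup c m = a m"
    using assms(2) finite_exponents[of n N]
    by (simp add: c_def lookup_sum lookup_single when_def)
  have "Poly_Mapping.keys c \<subseteq> (\<Union>m\<in>low. Poly_Mapping.keys (Poly_Mapping.single m (a m)))"
    unfolding c_def by (rule keys_sum)
  then have c: "c \<in> polys n" unfolding polys_iff_keys by (auto split: if_splits)
  have "lin_ext P c \<in> W" using assms(1) by (simp add: c_def lin_ext_sum)
  then have "tdeg n m > N"
    using lookup \<open>a m \<noteq> 0\<close> by (intro lin_ext_P_vanishing[OF c, of N]) (auto simp: W_def in_keys_iff)
  then show False using assms(2) by simp
qed

text \<open>The basis of the quotient is a set of cosets, so its cardinality is that of
  \<open>low\<close> only if no two cosets coincide.\<close>

lemma inj_on_coset_P: "inj_on (\<lambda>m. Q.coset (P m)) low"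
proof (rule inj_onI, rule ccontr)
  fix m m' assume m: "m \<in> low" "m' \<in> low" and eq: "Q.coset (P m) = Q.coset (P m')" and ne: "m \<noteq> m'"
  have "P m \<in> Q.coset (P m')" using Q.W.a_rcos_self[of "P m"] eq by simp
  then obtain w where w: "w \<in> W" "P m = w + P m'" unfolding a_r_coset_def' by auto
  have "(\<Sum>l\<in>low. pconst (of_bool (l = m) - of_bool (l = m')) * P l) =
     (\<Sum>l\<in>low. if l = m then P l else 0) - (\<Sum>l\<in>low. if l = m' then P l else 0)"
    unfolding sum_subtractf[symmetric] by (rule sum.cong) (auto simp: pconst.hom_uminus)
  also have "\<dots> = w" using m w finite_exponents[of n N] by simp
  finally have "(\<Sum>l\<in>low. pconst (of_bool (l = m) - of_bool (l = m')) * P l) \<in> W" using w by simp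
  from combination_in_W[OF this m(1)] ne show False by simp
qed

lemma finsum_coset:
  assumes "finite A" "A \<subseteq> exponents n"
  shows "(\<Oplus>\<^bsub>quot\<^esub>m\<in>A. a m \<odot>\<^bsub>quot\<^esub> Q.coset (P m)) = Q.coset (\<Sum>m\<in>A. pconst (a m) * P m)"
proof -
  interpret V: sl_module n quot by (rule sl_module_quot)
  have smult: "c \<odot>\<^bsub>quot\<^esub> Q.coset (P m) = Q.coset (pconst c * P m)" for c m
    using Q.quot_rep_smult[of "P m" c] by simp
  have car: "Q.coset f \<in> carrier quot" if "f \<in> polys n" for f
    using that by (simp add: Q.quot_rep_carrier)
  show ?thesis using assms
  proof (induction A)
    case empty
    show ?case using coset_eq_W[of 0] Q.W.zero_closed by (simp add: Q.quot_rep_zero)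
  next
    case (insert m A)
    have "(\<Oplus>\<^bsub>quot\<^esub>m\<in>insert m A. a m \<odot>\<^bsub>quot\<^esub> Q.coset (P m)) =
        a m \<odot>\<^bsub>quot\<^esub> Q.coset (P m) \<oplus>\<^bsub>quot\<^esub> (\<Oplus>\<^bsub>quot\<^esub>m\<in>A. a m \<odot>\<^bsub>quot\<^esub> Q.coset (P m))"
      using insert.hyps by (intro V.M.finsum_insert) (auto simp: smult intro: car)
    also have "\<dots> = Q.coset (pconst (a m) * P m + (\<Sum>m\<in>A. pconst (a m) * P m))"
      using insert Q.quot_rep_add[of "pconst (a m) * P m" "\<Sum>m\<in>A. pconst (a m) * P m"]
      by (simp add: smult)
    finally show ?case using insert.hyps by simp
  qed
qed

text \<open>Independence is \<open>combination_in_W\<close>. For spanning, expand in falling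
  factorials; the classes of the terms of degree above \<open>N\<close> are zero.\<close>

lemma basis_quot: "vectorspace.basis class_ring quot ((\<lambda>m. Q.coset (P m)) ` low)"
proof -
  interpret V: sl_module n quot by (rule sl_module_quot)
  let ?B = "(\<lambda>m. Q.coset (P m)) ` low"
  have fin: "finite ?B" using finite_exponents by simp
  have B: "?B \<subseteq> carrier quot" by (auto simp: Q.quot_rep_carrier)
  have "\<not> V.lin_dep ?B"
  proof (rule V.finite_lin_indpt2[OF fin B])
    fix a assume "V.lincomb a ?B = \<zero>\<^bsub>quot\<^esub>"
    also have "V.lincomb a ?B = (\<Oplus>\<^bsub>quot\<^esub>m\<in>low. a (Q.coset (P m)) \<odot>\<^bsub>quot\<^esub> Q.coset (P m))"
      unfolding V.lincomb_def
      by (rule V.M.finsum_reindex[OF _ inj_on_coset_P]) (use B V.smult_closed in \<open>auto simp: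
          subset_iff\<close>)
    also have "\<dots> = Q.coset (\<Sum>m\<in>low. pconst (a (Q.coset (P m))) * P m)"
      by (rule finsum_coset) (use finite_exponents in auto)
    finally have "(\<Sum>m\<in>low. pconst (a (Q.coset (P m))) * P m) \<in> W"
      unfolding Q.quot_rep_zero by (subst (asm) coset_eq_W) auto
    from combination_in_W[OF this] show "\<forall>v\<in>?B. a v = \<zero>\<^bsub>class_ring\<^esub>" by simp
  qed
  moreover have "V.span ?B = carrier quot"
  proof
    show "V.span ?B \<subseteq> carrier quot" by (rule V.span_is_subset2[OF B])
    interpret S: submodule class_ring "V.span ?B" quot by (rule V.span_is_submodule[OF B])
    have P: "Q.coset (P m) \<in> V.span ?B" if "m \<in> exponents n" for m
    proof (cases "m \<in> low")
      case True
      then show ?thesis using V.in_own_span[OF B] by blast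
    next
      case False
      then have "Q.coset (P m) = \<zero>\<^bsub>quot\<^esub>" using that by (simp add: coset_eq_W P_in_W
          Q.quot_rep_zero)
      then show ?thesis using S.zero_closed by simp
    qed
    have scaled: "Q.coset (pconst c * P m) \<in> V.span ?B" if "m \<in> exponents n" for c m
      using S.smult_closed[OF _ P[OF that], of c] Q.quot_rep_smult[of "P m" c] by simp
    have sum: "Q.coset (\<Sum>m\<in>A. pconst (a m) * P m) \<in> V.span ?B" if "finite A" "A \<subseteq> exponents n" for
        a A
      using that
    proof (induction A)
      case empty
      show ?case using S.zero_closed coset_eq_W[of 0] Q.W.zero_closed by (simp add: Q.quot_rep_zero)
    next
      case (insert m A)
      have "Q.coset (\<Sum>m\<in>insert m A. pconst (a m) * P m) =
          Q.coset (pconst (a m) * P m) \<oplus>\<^bsub>quot\<^esub> Q.coset (\<Sum>m\<in>A. pconst (a m) * P m)"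
        using insert.hyps Q.quot_rep_add[of "pconst (a m) * P m" "\<Sum>m\<in>A. pconst (a m) * P m"] by simp
      then show ?case using insert scaled by (simp add: S.m_closed)
    qed
    show "carrier quot \<subseteq> V.span ?B"
    proof
      fix X assume "X \<in> carrier quot"
      then obtain f where f: "f \<in> polys n" "X = Q.coset f" by (auto simp: Q.quot_rep_carrier)
      from f(1) obtain c where "c \<in> polys n" "f = lin_ext P c" by (rule polys_expansion)
      then show "X \<in> V.span ?B"
        using sum[of "Poly_Mapping.keys c"] f(2) by (simp add: lin_ext_def polys_iff_keys)
    qed
  qed
  ultimately show ?thesis using B by (simp add: V.basis_def)
qed

lemma dim_quot:
  "vectorspace.fin_dim class_ring quot" "vectorspace.dim class_ring quot = (N + n) choose n"
proof -
  interpret V: sl_module n quot by (rule sl_module_quot)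
  let ?B = "(\<lambda>m. Q.coset (P m)) ` low"
  have fin: "finite ?B" using finite_exponents by simp
  show "V.fin_dim" unfolding V.fin_dim_def using basis_quot fin by (auto simp: V.basis_def)
  show "V.dim = (N + n) choose n"
    using V.dim_basis[OF fin basis_quot] card_image[OF inj_on_coset_P] card_exponents by simp
qed

section \<open>The lowest weight vector\<close>

text \<open>Linear extension of the prescribed values on the h_k, by means of the expansion of a
  traceless diagonal matrix in the h_k.\<close>

definition low_weight :: "complex mat \<Rightarrow> complex" where
  "low_weight H = (\<Sum>k=1..n. (H $$ (k - 1, k - 1) - H $$ (n, n)) * (b - (if k = 1 then of_nat N
      else 0)))"

lemma low_weight_in_cartan_dual: "low_weight \<in> cartan_dual n"
proof -
  have add: "low_weight (H + K) = low_weight H + low_weight K" if "H \<in> cartan n" "K \<in> cartan n"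
      for H K
    unfolding low_weight_def sum.distrib[symmetric]
    by (rule sum.cong) (use that in \<open>auto simp: cartan_def sl_mat_def algebra_simps\<close>)
  have "low_weight (c \<cdot>\<^sub>m H) = c * low_weight H" if "H \<in> cartan n" for c H
    unfolding low_weight_def sum_distrib_left
    by (rule sum.cong) (use that in \<open>auto simp: cartan_def sl_mat_def algebra_simps\<close>)
  then show ?thesis using add by (simp add: cartan_dual_def)
qed

lemma low_weight_h_mat:
  assumes "i \<in> {1..n}"
  shows "low_weight (h_mat n i) = b - (if i = 1 then of_nat N else 0)"
proof -
  have "low_weight (h_mat n i) = (\<Sum>k=1..n. if k = i then b - (if k = 1 then of_nat N else 0) else
      0)"
    unfolding low_weight_def by (rule sum.cong) (use assms in \<open>auto simp: h_mat_def e_mat_def\<close>)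
  then show ?thesis using assms by simp
qed

text \<open>Among the points defining \<open>W\<close>, \<open>P lowest\<close> is nonzero only at
  the vertex x_1 = N, where h_1 = b - N and the other h_k equal b. This is where the weight comes
  from.\<close>

abbreviation lowest :: "nat \<Rightarrow>\<^sub>0 nat" where "lowest \<equiv> Poly_Mapping.single 1 N"

lemma lowest_in_exponents: "lowest \<in> exponents n" and tdeg_lowest: "tdeg n lowest = N"
  using n_pos add_single_in_exponents[of 0 n 1 N] tdeg_add_single[of 1 n 0 N] by simp_all

lemma P_lowest_add: "k \<in> {1..n} \<Longrightarrow> P (lowest + Poly_Mapping.single k 1) \<in> W"
  using lowest_in_exponents tdeg_lowest by (intro P_in_W add_single_in_exponents) (auto simp del:
      One_nat_def)

text \<open>Multiplication by h_k gives the eigenvalue b - m_k up to a product of degree N + 1,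
  which lies in \<open>W\<close>.\<close>

lemma cartan_act_lowest:
  assumes "H \<in> cartan n"
  shows "M_act n b H (P lowest) - pconst (low_weight H) * P lowest \<in> W"
proof -
  have off: "H $$ (i - 1, j - 1) = 0" if "i \<in> {1..Suc n}" "j \<in> {1..Suc n} - {i}" for i j
    using that assms by (auto simp: cartan_def)
  have "M_act n b H (P lowest) = (\<Sum>k=1..n. pconst (H $$ (k - 1, k - 1) - H $$ (n, n)) * (hvar k *
      P lowest))"
    unfolding M_act_def by (simp only: off pconst_simps mult_zero_left sum.neutral_const
        add_0_left cong: sum.cong)
  also have "\<dots> = (\<Sum>k=1..n. pconst (H $$ (k - 1, k - 1) - H $$ (n, n)) *
     (pconst (b - (if k = 1 then of_nat N else 0)) * P lowest - P (lowest + Poly_Mapping.single k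
         1)))"
  proof (rule sum.cong[OF refl])
    fix k assume k: "k \<in> {1..n}"
    have "of_nat (Poly_Mapping.lookup lowest k) = pconst (if k = 1 then of_nat N else 0)"
      by (simp add: lookup_single when_def pconst_of_nat)
    then have "hvar k * P lowest = pconst (b - (if k = 1 then of_nat N else 0)) * P lowest -
        P (lowest + Poly_Mapping.single k 1)"
      unfolding P_add_single[OF k] using k by (simp add: x_def pconst.hom_minus algebra_simps)
    then show "pconst (H $$ (k - 1, k - 1) - H $$ (n, n)) * (hvar k * P lowest) =
        pconst (H $$ (k - 1, k - 1) - H $$ (n, n)) * (pconst (b - (if k = 1 then of_nat N else 0))
            * P lowest -
          P (lowest + Poly_Mapping.single k 1))"
      by (rule arg_cong)
  qed
  also have "\<dots> = pconst (low_weight H) * P lowest -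
      (\<Sum>k=1..n. pconst (H $$ (k - 1, k - 1) - H $$ (n, n)) * P (lowest + Poly_Mapping.single k 1))"
    unfolding low_weight_def pconst.hom_sum sum_distrib_right sum_subtractf[symmetric]
    unfolding pconst_mult by (rule sum.cong) (simp_all only: right_diff_distrib mult.assoc)
  finally have "M_act n b H (P lowest) - pconst (low_weight H) * P lowest = 0 -
      (\<Sum>k=1..n. pconst (H $$ (k - 1, k - 1) - H $$ (n, n)) * P (lowest + Poly_Mapping.single k 1))"
    by simp
  also have "\<dots> \<in> W"
    by (intro Uh_ideal_diff[OF W_ideal] Uh_idealD(2)[OF W_ideal] Uh_ideal_sum[OF W_ideal]
        Uh_ideal_scale[OF W_ideal] P_lowest_add)
  finally show ?thesis .
qed

text \<open>A strictly lower matrix unit has j < i, hence j at most n, and maps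
  \<open>P lowest\<close> up to sign to a product of degree N + 1.\<close>

lemma lower_act_lowest:
  assumes A: "A \<in> strictly_lower n"
  shows "A \<in> sl_mat n" "M_act n b A (P lowest) \<in> W"
proof -
  have zero: "A $$ (r, c) = 0" if "r \<le> c" "c < Suc n" for r c
    using A that by (simp add: strictly_lower_def)
  show sl: "A \<in> sl_mat n" using A zero by (simp add: strictly_lower_def sl_mat_def)
  have unit: "x j * shift i j (P lowest) \<in> W" if ij: "j < i" "j \<in> {1..Suc n}" "i \<in> {1..Suc n}" for
      i j
  proof -
    have P1: "P lowest = ffact (x 1) N" using n_pos by (intro P_single) simp
    have j: "j \<in> {1..n}" using ij by auto
    \<comment> \<open>Since i > j, the index i is not 1; so x_1 can only be lowered, namely when j =
      1.\<close>
    have sh: "shift i j (P lowest) = ffact (x 1 - of_bool (j = 1)) N"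
      unfolding P1 shift.hom_ffact using ij n_pos by (subst shift_x) auto
    show ?thesis
    proof (cases "j = 1")
      case True
      have "x j * shift i j (P lowest) = ffact (x 1) (Suc N)"
        using sh True ffact_Suc_left[of "x 1 - 1" N] by simp
      also have "\<dots> = P (lowest + Poly_Mapping.single 1 1)"
        using n_pos P_single[of 1 "Suc N"] by (simp flip: single_add del: ffact.simps)
      finally show ?thesis using P_lowest_add[of 1] n_pos by simp
    next
      case False
      have "shift i j (P lowest) = P lowest" unfolding sh unfolding P1 using False by simp
      then have "x j * shift i j (P lowest) = P (lowest + Poly_Mapping.single j 1)"
        unfolding P_add_single[OF j] using False by (simp add: lookup_single when_def)
      then show ?thesis using P_lowest_add[OF j] by simp
    qed
  qed
  have "pconst (entry A i j) * (x j * shift i j (P lowest)) \<in> W"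
    if "i \<in> {1..Suc n}" "j \<in> {1..Suc n}" for i j
  proof (cases "j < i")
    case True
    then show ?thesis using unit that by (intro Uh_ideal_scale[OF W_ideal]) auto
  next
    case False
    then have "entry A i j = 0" using zero[of "i - 1" "j - 1"] that by (auto simp: entry_def)
    then show ?thesis using Uh_idealD(2)[OF W_ideal] by simp
  qed
  then have "unit_act (entry A) (P lowest) \<in> W"
    unfolding unit_act_def by (intro Uh_ideal_sum[OF W_ideal])
  then have "0 - unit_act (entry A) (P lowest) \<in> W"
    by (intro Uh_ideal_diff[OF W_ideal] Uh_idealD(2)[OF W_ideal])
  then show "M_act n b A (P lowest) \<in> W" by (simp add: M_act_eq[OF sl])
qed

lemma has_lowest_weight_quot: "has_lowest_weight n quot low_weight"
  unfolding has_lowest_weight_def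
proof (intro bexI conjI ballI)
  let ?v = "Q.coset (P lowest)"
  have closed: "M_act n b A (P lowest) \<in> polys n" if "A \<in> sl_mat n" for A
    using Q.act_closed[of A "P lowest"] that by simp
  show "?v \<in> carrier quot" by (simp add: Q.quot_rep_carrier)
  have "P lowest \<notin> W"
  proof
    assume "P lowest \<in> W"
    then have "\<forall>m\<in>exponents n. tdeg n m \<le> N \<longrightarrow> ev b m (P lowest) = 0" by (simp add: W_def)
    from bspec[OF this lowest_in_exponents] have "ev b lowest (P lowest) = 0"
      unfolding tdeg_lowest by blast
    then show False using ev_P_same by blast
  qed
  then show "?v \<noteq> \<zero>\<^bsub>quot\<^esub>" by (simp add: coset_eq_W Q.quot_rep_zero)
  fix H assume H: "H \<in> cartan n"
  then have sl: "H \<in> sl_mat n" by (simp add: cartan_def)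
  have "act quot H ?v = Q.coset (M_act n b H (P lowest))" using Q.quot_rep_act[OF sl, of "P
      lowest"] by simp
  also have "\<dots> = Q.coset (pconst (low_weight H) * P lowest)"
    by (rule coset_eq[OF closed[OF sl] _ cartan_act_lowest[OF H]]) auto
  also have "\<dots> = low_weight H \<odot>\<^bsub>quot\<^esub> ?v" using Q.quot_rep_smult[of "P lowest"] by simp
  finally show "act quot H ?v = low_weight H \<odot>\<^bsub>quot\<^esub> ?v" .
next
  let ?v = "Q.coset (P lowest)"
  fix A assume A: "A \<in> strictly_lower n"
  note sl = lower_act_lowest[OF A]
  have "act quot A ?v = Q.coset (M_act n b A (P lowest))" using Q.quot_rep_act[OF sl(1), of "P
      lowest"] by simp
  also have "\<dots> = W" using Q.W.a_rcos_const[OF sl(2)] by simp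
  finally show "act quot A ?v = \<zero>\<^bsub>quot\<^esub>" by (simp add: Q.quot_rep_zero)
qed

end

theorem theorem34:
  fixes n :: nat and b :: complex
  assumes "n \<ge> 1" and "of_nat (n + 1) * b \<in> \<nat>"
  shows "sl_module n (M_rep n b) \<and>
    (\<exists>W. (\<forall>W'. nonzero_proper_submodule n (M_rep n b) W' \<longleftrightarrow> W' = W) \<and>
      simple_sl_module n (sub_rep (M_rep n b) W) \<and>
      in_frakM n (sub_rep (M_rep n b) W) \<and>
      (n \<ge> 2 \<longrightarrow> \<not> in_calM n (sub_rep (M_rep n b) W)) \<and>
      simple_sl_module n (quot_rep (M_rep n b) W) \<and>
      vectorspace.fin_dim (class_ring :: complex ring) (quot_rep (M_rep n b) W) \<and>
      of_nat (vectorspace.dim (class_ring :: complex ring) (quot_rep (M_rep n b) W)) =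
        (of_nat (n + 1) * b + of_nat n) gchoose n \<and>
      (\<exists>wt\<in>cartan_dual n.
        (\<forall>i\<in>{1..n}. wt (h_mat n i) = b - (if i = 1 then of_nat (n + 1) * b else 0)) \<and>
        has_lowest_weight n (quot_rep (M_rep n b) W) wt))"
proof -
  from assms(2) obtain N where "of_nat (n + 1) * b = of_nat N" by (auto elim: Nats_cases)
  then interpret weight_module n b N using assms(1) by unfold_locales
  have "vectorspace.dim class_ring quot = (N + n) choose n" by (rule dim_quot)
  \<comment> \<open>As (n + 1) b is a complex number, the dimension is compared in the complex
    numbers through the generalized binomial coefficient.\<close>
  then have dim: "of_nat (vectorspace.dim class_ring quot) = (of_nat (n + 1) * b + of_nat n)
      gchoose n"
    unfolding N_eq by (simp add: binomial_gbinomial)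
  have sub_simple: "simple_sl_module n (sub_rep (M_rep n b) W)"
  proof (rule simple_sub_rep[OF sl_module_M_rep W_submodule])
    fix U assume "sl_submodule n (M_rep n b) U" "U \<noteq> {\<zero>\<^bsub>M_rep n b\<^esub>}" "U \<subseteq> W"
    then show "U = W" using W_minimal[of U] by (simp add: sl_submodule_iff_stable)
  qed (simp add: W_neq_zero)
  have quot_simple: "simple_sl_module n quot"
  proof (rule Q.simple_quot_rep)
    show "W \<noteq> carrier (M_rep n b)" using one_notin_W one_in_polys[of n] by (metis M_rep_simps(1))
    show "U = W \<or> U = carrier (M_rep n b)" if "sl_submodule n (M_rep n b) U" "W \<subseteq> U" for U
      using that W_maximal[of U] by (auto simp: sl_submodule_iff_stable)
  qed
  have sub: "sl_module n (sub_rep (M_rep n b) W)" by (rule sl_module_sub_rep[OF sl_module_M_rep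
      W_submodule])
  show ?thesis
  proof (intro conjI exI[of _ W])
    show "\<exists>wt\<in>cartan_dual n.
        (\<forall>i\<in>{1..n}. wt (h_mat n i) = b - (if i = 1 then of_nat (n + 1) * b else 0)) \<and>
        has_lowest_weight n quot wt"
      by (intro bexI[of _ low_weight] conjI ballI low_weight_in_cartan_dual has_lowest_weight_quot)
        (simp only: low_weight_h_mat N_eq)
    show "\<forall>W'. nonzero_proper_submodule n (M_rep n b) W' \<longleftrightarrow> W' = W"
      by (simp add: nonzero_proper_submodule_iff)
    show "in_frakM n (sub_rep (M_rep n b) W)"
      using sub finitely_generated_W by (simp add: in_frakM_def)
    show "n \<ge> 2 \<longrightarrow> \<not> in_calM n (sub_rep (M_rep n b) W)"
      using not_free_W by (simp add: in_calM_def)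
  qed (fact sl_module_M_rep sub_simple quot_simple dim dim_quot(1))+
qed

end
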